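(* \textsc{ConsCheck: Matching} admits an algorithm which runs in time $2^{\mathcal{O}(k+t^-)}\cdot|\mathcal{I}|^{\mathcal{O}(1)}$; in particular, the problem is fixed-parameter tractable when parameterized by $k+t^-$.
   Context: \textsc{ConsCheck: Matching}: Input $\mathcal{I}$: a finite vertex set $V$, labeled samples $(E_i,\lambda_i)_{i\in[t]}$ where each $G_i=(V,E_i)$ is a graph and $\lambda_i\in\{0,1\}$, and an integer $k$. Task: compute $F\subseteq\binom{V}{2}$ with $|F|=k$ such that for each $i\in[t]$, $F$ forms a matching in $G_i$ ($F\subseteq E_i$ and the pairs of $F$ are pairwise vertex-disjoint) iff $\lambda_i=1$, or report that none exists. $t^-=|\{i:\lambda_i=0\}|$ is the number of negative samples. *)

theory Defs
  imports "HOL-Library.Ramsey" "HOL-Library.Disjoint_Sets" "HOL-Library.Discrete_Functions"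
begin

section \<open>Model of computation\<close>

text \<open>
  Algorithms are programs of a deterministic first-order functional language (call by value,
  general recursion) over binary trees with natural-number leaves. Trees are handled by reference,
  so building and taking apart cells costs one unit. Arithmetic is charged by the logarithmic cost
  criterion, i.e. the bit lengths of the operands are paid for, and there is no unit-cost comparison
  of whole trees. Running times therefore agree with those of multitape Turing machines and
  logarithmic-cost random access machines up to a polynomial.
\<close>

datatype val = Atom nat | Cell val val

definition bit_length :: "nat \<Rightarrow> nat" where
  "bit_length n = Suc (floor_log n)"

primrec val_size :: "val \<Rightarrow> nat" where
  "val_size (Atom n) = bit_length n"
| "val_size (Cell a b) = Suc (val_size a + val_size b)"

datatype binop = Plus | Minus | Times | Divide | Modulo | Less | Equal

primrec binop_val :: "binop \<Rightarrow> nat \<Rightarrow> nat \<Rightarrow> nat" where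
  "binop_val Plus m n = m + n"
| "binop_val Minus m n = m - n"
| "binop_val Times m n = m * n"
| "binop_val Divide m n = m div n"
| "binop_val Modulo m n = m mod n"
| "binop_val Less m n = of_bool (m < n)"
| "binop_val Equal m n = of_bool (m = n)"

text \<open>
  Variables are de Bruijn indices into the environment. The argument of \<open>Call\<close> is the position of
  the called function in the program; every function has a single parameter.
\<close>

datatype expr =
    Var nat
  | Lit nat
  | Op binop expr expr
  | Mk_Cell expr expr
  | Head expr
  | Tail expr
  | Is_Cell expr
  | If_Nonzero expr expr expr
  | Let_In expr expr
  | Call nat expr

type_synonym prog = "expr list"

text \<open>\<open>eval p env e v c\<close>: the expression \<open>e\<close> evaluates to \<open>v\<close> in \<open>c\<close> time units.\<close>

inductive eval :: "prog \<Rightarrow> val list \<Rightarrow> expr \<Rightarrow> val \<Rightarrow> nat \<Rightarrow> bool" for p :: prog where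
  eval_Var: "i < length env \<Longrightarrow> eval p env (Var i) (env ! i) 1"
| eval_Lit: "eval p env (Lit n) (Atom n) 1"
| eval_Op: "eval p env a (Atom m) c1 \<Longrightarrow> eval p env b (Atom n) c2 \<Longrightarrow>
    eval p env (Op f a b) (Atom (binop_val f m n)) (1 + c1 + c2 + bit_length m + bit_length n)"
| eval_Mk_Cell: "eval p env a v c1 \<Longrightarrow> eval p env b w c2 \<Longrightarrow>
    eval p env (Mk_Cell a b) (Cell v w) (1 + c1 + c2)"
| eval_Head: "eval p env a (Cell v w) c \<Longrightarrow> eval p env (Head a) v (1 + c)"
| eval_Tail: "eval p env a (Cell v w) c \<Longrightarrow> eval p env (Tail a) w (1 + c)"
| eval_Is_Cell: "eval p env a v c \<Longrightarrow>
    eval p env (Is_Cell a) (Atom (of_bool (\<exists>x y. v = Cell x y))) (1 + c)"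
| eval_If_True: "eval p env a v c1 \<Longrightarrow> v \<noteq> Atom 0 \<Longrightarrow> eval p env b w c2 \<Longrightarrow>
    eval p env (If_Nonzero a b d) w (1 + c1 + c2)"
| eval_If_False: "eval p env a (Atom 0) c1 \<Longrightarrow> eval p env d w c2 \<Longrightarrow>
    eval p env (If_Nonzero a b d) w (1 + c1 + c2)"
| eval_Let_In: "eval p env a v c1 \<Longrightarrow> eval p (v # env) b w c2 \<Longrightarrow>
    eval p env (Let_In a b) w (1 + c1 + c2)"
| eval_Call: "eval p env a v c1 \<Longrightarrow> g < length p \<Longrightarrow> eval p [v] (p ! g) w c2 \<Longrightarrow>
    eval p env (Call g a) w (1 + c1 + c2)"

inductive_cases eval_VarE: "eval p env (Var i) v c"
inductive_cases eval_LitE: "eval p env (Lit n) v c"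
inductive_cases eval_OpE: "eval p env (Op f a b) v c"
inductive_cases eval_Mk_CellE: "eval p env (Mk_Cell a b) v c"
inductive_cases eval_HeadE: "eval p env (Head a) v c"
inductive_cases eval_TailE: "eval p env (Tail a) v c"
inductive_cases eval_Is_CellE: "eval p env (Is_Cell a) v c"
inductive_cases eval_If_NonzeroE: "eval p env (If_Nonzero a b d) v c"
inductive_cases eval_Let_InE: "eval p env (Let_In a b) v c"
inductive_cases eval_CallE: "eval p env (Call g a) v c"

lemma eval_deterministic:
  assumes "eval p env e v c" and "eval p env e v' c'"
  shows "v' = v \<and> c' = c"
  using assms
proof (induction arbitrary: v' c' rule: eval.induct)
  case eval_Var then show ?case by (auto elim: eval_VarE)
next
  case eval_Lit then show ?case by (auto elim: eval_LitE)
next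
  case eval_Op
  from eval_Op.prems show ?case
    by (rule eval_OpE) (auto dest!: eval_Op.IH)
next
  case eval_Mk_Cell
  from eval_Mk_Cell.prems show ?case
    by (rule eval_Mk_CellE) (auto dest!: eval_Mk_Cell.IH)
next
  case eval_Head
  from eval_Head.prems show ?case
    by (rule eval_HeadE) (auto dest!: eval_Head.IH)
next
  case eval_Tail
  from eval_Tail.prems show ?case
    by (rule eval_TailE) (auto dest!: eval_Tail.IH)
next
  case eval_Is_Cell
  from eval_Is_Cell.prems show ?case
    by (rule eval_Is_CellE) (auto dest!: eval_Is_Cell.IH)
next
  case eval_If_True
  from eval_If_True.prems show ?case
    by (rule eval_If_NonzeroE) (use eval_If_True.hyps in \<open>auto dest!: eval_If_True.IH\<close>)
next
  case eval_If_False
  from eval_If_False.prems show ?case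
    by (rule eval_If_NonzeroE) (auto dest!: eval_If_False.IH)
next
  case eval_Let_In
  from eval_Let_In.prems show ?case
    by (rule eval_Let_InE) (auto dest!: eval_Let_In.IH)
next
  case eval_Call
  from eval_Call.prems show ?case
    by (rule eval_CallE) (auto dest!: eval_Call.IH)
qed

text \<open>A program is started by applying its function number 0 to the input.\<close>

definition runs :: "prog \<Rightarrow> val \<Rightarrow> val \<Rightarrow> nat \<Rightarrow> bool" where
  "runs p x y c \<longleftrightarrow> eval p [x] (Call 0 (Var 0)) y c"

definition computable :: "(nat \<Rightarrow> nat) \<Rightarrow> bool" where
  "computable f \<longleftrightarrow> (\<exists>p. \<forall>n. \<exists>c. runs p (Atom n) (Atom (f n)) c)"

section \<open>Encodings\<close>

text \<open>
  Encodings are relations between objects and trees, because a set is presented by listing its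
  elements in an arbitrary order, and an edge by naming its two ends in an arbitrary order.
\<close>

primrec list_code :: "('a \<Rightarrow> val \<Rightarrow> bool) \<Rightarrow> 'a list \<Rightarrow> val \<Rightarrow> bool" where
  "list_code R [] v \<longleftrightarrow> v = Atom 0"
| "list_code R (x # xs) v \<longleftrightarrow> (\<exists>a b. v = Cell a b \<and> R x a \<and> list_code R xs b)"

definition set_code :: "('a \<Rightarrow> val \<Rightarrow> bool) \<Rightarrow> 'a set \<Rightarrow> val \<Rightarrow> bool" where
  "set_code R A v \<longleftrightarrow> (\<exists>xs. distinct xs \<and> set xs = A \<and> list_code R xs v)"

definition nat_code :: "nat \<Rightarrow> val \<Rightarrow> bool" where
  "nat_code n v \<longleftrightarrow> v = Atom n"

definition bool_code :: "bool \<Rightarrow> val \<Rightarrow> bool" where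
  "bool_code b v \<longleftrightarrow> v = Atom (of_bool b)"

definition edge_code :: "nat set \<Rightarrow> val \<Rightarrow> bool" where
  "edge_code e v \<longleftrightarrow> (\<exists>x y. e = {x, y} \<and> v = Cell (Atom x) (Atom y))"

definition prod_code ::
  "('a \<Rightarrow> val \<Rightarrow> bool) \<Rightarrow> ('b \<Rightarrow> val \<Rightarrow> bool) \<Rightarrow> 'a \<times> 'b \<Rightarrow> val \<Rightarrow> bool" where
  "prod_code R S z v \<longleftrightarrow> (\<exists>a b. v = Cell a b \<and> R (fst z) a \<and> S (snd z) b)"

primrec option_code :: "('a \<Rightarrow> val \<Rightarrow> bool) \<Rightarrow> 'a option \<Rightarrow> val \<Rightarrow> bool" where
  "option_code R None v \<longleftrightarrow> v = Atom 0"
| "option_code R (Some x) v \<longleftrightarrow> (\<exists>a. v = Cell a (Atom 0) \<and> R x a)"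

section \<open>Search problems and fixed-parameter tractability\<close>

record ('i, 's) search_problem =
  instances :: "'i set"
  is_solution :: "'i \<Rightarrow> 's \<Rightarrow> bool"
  instance_code :: "'i \<Rightarrow> val \<Rightarrow> bool"
  solution_code :: "'s \<Rightarrow> val \<Rightarrow> bool"

text \<open>The answer \<open>None\<close> reports that there is no solution.\<close>

primrec correct_answer :: "('i, 's) search_problem \<Rightarrow> 'i \<Rightarrow> 's option \<Rightarrow> bool" where
  "correct_answer P I None \<longleftrightarrow> \<not> (\<exists>s. is_solution P I s)"
| "correct_answer P I (Some s) \<longleftrightarrow> is_solution P I s"

text \<open>The time bound \<open>T\<close> depends on the instance and on the size of its encoding.\<close>

definition solves_within ::
  "prog \<Rightarrow> ('i, 's) search_problem \<Rightarrow> ('i \<Rightarrow> nat \<Rightarrow> nat) \<Rightarrow> bool" where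
  "solves_within p P T \<longleftrightarrow>
    (\<forall>I\<in>instances P. \<forall>x. instance_code P I x \<longrightarrow>
      (\<exists>y c ans. runs p x y c \<and> c \<le> T I (val_size x) \<and>
        option_code (solution_code P) ans y \<and> correct_answer P I ans))"

definition fixed_parameter_tractable ::
  "('i, 's) search_problem \<Rightarrow> ('i \<Rightarrow> nat) \<Rightarrow> bool" where
  "fixed_parameter_tractable P \<kappa> \<longleftrightarrow>
    (\<exists>p f d. computable f \<and> solves_within p P (\<lambda>I n. f (\<kappa> I) * n ^ d))"

section \<open>Consistency checking for matchings\<close>

definition matching_in :: "'v set set \<Rightarrow> 'v set set \<Rightarrow> bool" where
  "matching_in E F \<longleftrightarrow> F \<subseteq> E \<and> disjoint F"

record matching_instance =
  vertices :: "nat set"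
  samples :: "(nat set set \<times> bool) list"
  solution_size :: nat

definition valid_instance :: "matching_instance \<Rightarrow> bool" where
  "valid_instance I \<longleftrightarrow>
    finite (vertices I) \<and> (\<forall>(E, l)\<in>set (samples I). E \<subseteq> [vertices I]\<^bsup>2\<^esup>)"

definition consistent_matching :: "matching_instance \<Rightarrow> nat set set \<Rightarrow> bool" where
  "consistent_matching I F \<longleftrightarrow>
    F \<subseteq> [vertices I]\<^bsup>2\<^esup> \<and> card F = solution_size I \<and>
    (\<forall>(E, l)\<in>set (samples I). matching_in E F \<longleftrightarrow> l)"

definition num_negative :: "matching_instance \<Rightarrow> nat" where
  "num_negative I = card {i. i < length (samples I) \<and> \<not> snd (samples I ! i)}"

definition matching_instance_code :: "matching_instance \<Rightarrow> val \<Rightarrow> bool" where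
  "matching_instance_code I =
    prod_code (set_code nat_code)
      (prod_code (list_code (prod_code (set_code edge_code) bool_code)) nat_code)
      (vertices I, samples I, solution_size I)"

definition ConsCheck_Matching :: "(matching_instance, nat set set) search_problem" where
  "ConsCheck_Matching =
    \<lparr>instances = {I. valid_instance I},
     is_solution = consistent_matching,
     instance_code = matching_instance_code,
     solution_code = set_code edge_code\<rparr>"

lemma list_code_exists: "(\<And>x. x \<in> set xs \<Longrightarrow> \<exists>v. R x v) \<Longrightarrow> \<exists>v. list_code R xs v"
proof (induction xs)
  case (Cons x xs)
  then obtain a b where "R x a" "list_code R xs b" by (meson list.set_intros)
  then have "list_code R (x # xs) (Cell a b)" by simp
  then show ?case by blast
next
  case Nil
  have "list_code R [] (Atom 0)" by simp
  then show ?case by blast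
qed

lemma set_code_exists: "finite A \<Longrightarrow> (\<And>x. x \<in> A \<Longrightarrow> \<exists>v. R x v) \<Longrightarrow> \<exists>v. set_code R A v"
  using finite_distinct_list[of A] list_code_exists[of _ R] unfolding set_code_def by blast

lemma prod_code_exists: "\<exists>v. R a v \<Longrightarrow> \<exists>v. S b v \<Longrightarrow> \<exists>v. prod_code R S (a, b) v"
  unfolding prod_code_def by auto

lemma edge_code_exists: "e \<in> [V]\<^bsup>2\<^esup> \<Longrightarrow> \<exists>v. edge_code e v"
  unfolding nsets_def edge_code_def by (auto simp: card_2_iff)

lemma matching_instance_code_exists:
  assumes "valid_instance I"
  shows "\<exists>x. matching_instance_code I x"
proof -
  have "\<exists>v. prod_code (set_code edge_code) bool_code s v" if "s \<in> set (samples I)" for s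
  proof -
    obtain E l where s: "s = (E, l)" by (cases s)
    with assms that have E: "finite (vertices I)" "E \<subseteq> [vertices I]\<^bsup>2\<^esup>"
      unfolding valid_instance_def by auto
    then have "finite E"
      using finite_imp_finite_nsets finite_subset by blast
    with E show ?thesis
      unfolding s by (intro prod_code_exists set_code_exists)
        (auto simp: bool_code_def intro: edge_code_exists)
  qed
  with assms show ?thesis
    unfolding matching_instance_code_def
    by (intro prod_code_exists set_code_exists list_code_exists)
      (auto simp: nat_code_def valid_instance_def)
qed

lemma list_code_unique:
  "(\<And>x y v. R x v \<Longrightarrow> R y v \<Longrightarrow> x = y) \<Longrightarrow> list_code R xs v \<Longrightarrow> list_code R ys v \<Longrightarrow> xs = ys"
proof (induction xs arbitrary: ys v)
  case Nil then show ?case by (cases ys) auto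
next
  case (Cons x xs)
  from Cons.prems(2) obtain a b where v: "v = Cell a b" "R x a" "list_code R xs b" by auto
  with Cons.prems(3) obtain y zs where ys: "ys = y # zs" "R y a" "list_code R zs b"
    by (cases ys) auto
  have "x = y" using Cons.prems(1) v(2) ys(2) .
  moreover have "xs = zs" by (rule Cons.IH[OF _ v(3) ys(3)]) (rule Cons.prems(1))
  ultimately show ?case using ys(1) by simp
qed

text \<open>An output determines the answer it encodes.\<close>

lemma answer_unique:
  assumes "option_code (set_code edge_code) a v" and "option_code (set_code edge_code) b v"
  shows "a = b"
proof -
  have edge: "e = f" if "edge_code e w" "edge_code f w" for e f w
    using that unfolding edge_code_def by auto
  have "A = B" if "set_code edge_code A w" "set_code edge_code B w" for A B w
    using that list_code_unique[of edge_code] edge unfolding set_code_def by metis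
  with assms show ?thesis by (cases a; cases b) auto
qed

end

theory Submission
  imports Defs
begin

text \<open>
  Assign to every vertex \<open>v\<close> the vector \<open>(1, v, v\<^sup>2, \<dots>)\<close> of length \<open>2 k\<close>. Wedging the vectors of
  the \<open>2 k\<close> ends of a \<open>k\<close>-tuple of edges gives a Vandermonde determinant, which vanishes exactly if
  two ends coincide. Doing this simultaneously in two copies of the exterior algebra gives the square
  of the determinant up to a sign depending on \<open>k\<close> only, so the sum over all \<open>k\<close>-tuples of edges is
  nonzero if and only if one of them is a matching. Since wedging is linear, this sum is computed by
  applying the operator of the sum of all edges \<open>k\<close> times to a vector with \<open>2 ^ (4 * k)\<close> coordinates.
  Positive samples restrict the set of edges, and the condition that the tuple leaves each negative
  sample is imposed by inclusion-exclusion over the \<open>2 ^ t\<close> sets of negative samples. All numbers are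
  kept modulo some \<open>N\<close> larger than the sum. A solution is found by deleting edges as long as the sum
  stays nonzero.

  Without a positive sample a solution need not be a matching. If then \<open>k \<ge> 2\<close>, any \<open>k\<close> pairs two of
  which share a vertex are a solution.
\<close>

section \<open>Exterior algebra and Vandermonde determinants\<close>

text \<open>Any \<open>2 k\<close> distinct points of the moment curve give independent vectors, so
  the dimension depends on \<open>k\<close> alone, however many vertices there are. A single copy of
  the algebra would not do: different matchings can have determinants of opposite sign, and their
  terms could cancel. Squaring removes this deterministically, where one would otherwise use random
  coefficients; passing from sets to tuples only repeats each matching with equal terms. For
  pairwise disjoint edges, failing a negative sample just means not being contained in it. The
  algebra therefore takes care of disjointness, and the samples only restrict the edge list. Since
  containment conditions of positive samples never branch, the exponential cost of the samples is
  governed by the negative ones. The language works on naturals with truncated subtraction; residues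
  modulo \<open>N\<close> supply signs (\<open>N - 1\<close> plays the role of -1), and as the sum
  is below \<open>N\<close> in absolute value, testing its residue for zero is exact.\<close>

text \<open>
  A function on bit lists of length \<open>d\<close> represents an element of the exterior algebra of a
  \<open>d\<close>-dimensional space: the bit list selects the basis vectors of a basis monomial. \<open>wedge\<close> multiplies
  by a vector on the right. Splitting off the first basis vector \<open>x\<close>, which is written last in every
  monomial, it computes \<open>(f\<^sub>0 + f\<^sub>1 x) (u + c x) = f\<^sub>0 u + (c f\<^sub>0 - f\<^sub>1 u) x\<close>.
\<close>

fun wedge :: "int list \<Rightarrow> (bool list \<Rightarrow> int) \<Rightarrow> bool list \<Rightarrow> int" where
  "wedge (c # u) f (False # b) = wedge u (\<lambda>r. f (False # r)) b"
| "wedge (c # u) f (True # b) = c * f (False # b) - wedge u (\<lambda>r. f (True # r)) b"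
| "wedge [] f b = 0"
| "wedge (c # u) f [] = 0"

lemma wedge_linear:
  "wedge u (\<lambda>b. p * f b + q * g b) b = p * wedge u f b + q * wedge u g b"
proof (induction u f b arbitrary: g rule: wedge.induct)
  case (1 c u f b)
  show ?case using "1.IH"[of "\<lambda>r. g (False # r)"] by simp
next
  case (2 c u f b)
  show ?case using "2.IH"[of "\<lambda>r. g (True # r)"] by (simp add: algebra_simps)
qed simp_all

lemma wedge_zero [simp]: "wedge u (\<lambda>b. 0) b = 0"
  using wedge_linear[of u 0 "\<lambda>_. 0" 0 "\<lambda>_. 0"] by simp

lemma wedge_scale: "wedge u (\<lambda>b. p * f b) = (\<lambda>b. p * wedge u f b)"
  using wedge_linear[of u p f 0 f] by auto

lemma wedge_diff: "wedge u (\<lambda>b. p * f b - g b) b = p * wedge u f b - wedge u g b"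
  using wedge_linear[of u p f "-1" g] by simp

lemma wedge_add: "wedge u (\<lambda>b. f b + g b) b = wedge u f b + wedge u g b"
  using wedge_linear[of u 1 f 1 g] by simp

lemma wedge_sum: "wedge u (\<lambda>b. \<Sum>i\<in>A. f i b) = (\<lambda>b. \<Sum>i\<in>A. wedge u (f i) b)"
  by (rule ext, induction A rule: infinite_finite_induct) (simp_all add: wedge_add)

lemma wedge_cong:
  "(\<And>r. length r = length b \<Longrightarrow> f r = g r) \<Longrightarrow> wedge u f b = wedge u g b"
proof (induction u f b arbitrary: g rule: wedge.induct)
  case (1 c u f b)
  show ?case using "1.IH"[of "\<lambda>r. g (False # r)"] "1.prems" by simp
next
  case (2 c u f b)
  show ?case using "2.IH"[of "\<lambda>r. g (True # r)"] "2.prems" by simp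
qed simp_all

text \<open>Split off the first coordinates \<open>c\<close> and \<open>d\<close> of the two
  vectors. On monomials with the first basis vector, the terms containing \<open>c\<close> or
  \<open>d\<close> are antisymmetric under the exchange, and what remains is the induction
  hypothesis.\<close>

lemma wedge_anticommute: "wedge u (wedge v f) b = - wedge v (wedge u f) b"
proof (induction u arbitrary: v f b)
  case Nil
  have "wedge [] f = (\<lambda>b. 0)" by auto
  then show ?case by simp
next
  case (Cons c u)
  have nil: "wedge [] f = (\<lambda>b. 0)" by auto
  show ?case
  proof (cases v)
    case Nil
    then show ?thesis by (simp add: nil)
  next
    case v: (Cons d v')
    show ?thesis
    proof (cases b)
      case b: (Cons x b')
      show ?thesis
        by (cases x) (simp_all add: v b wedge_diff Cons.IH[of v'])
    qed (simp add: v)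
  qed
qed

lemma wedge_self: "wedge u (wedge u f) b = 0"
  using wedge_anticommute[of u u f b] by simp

text \<open>Each entry of \<open>u\<close> is multiplied with at most one coefficient of
  \<open>f\<close>, so the growth is governed by the l1 norm of \<open>u\<close>.\<close>

lemma wedge_bound:
  assumes "\<And>r. \<bar>f r\<bar> \<le> B"
  shows "\<bar>wedge u f b\<bar> \<le> (\<Sum>c\<leftarrow>u. \<bar>c\<bar>) * B"
  using assms
proof (induction u f b rule: wedge.induct)
  case (1 c u f b)
  have "0 \<le> B" using "1.prems" abs_ge_zero order_trans by blast
  then have "0 \<le> \<bar>c\<bar> * B" by simp
  moreover have "\<bar>wedge u (\<lambda>r. f (False # r)) b\<bar> \<le> (\<Sum>c\<leftarrow>u. \<bar>c\<bar>) * B"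
    by (rule "1.IH") (rule "1.prems")
  ultimately show ?case by (simp add: distrib_right)
next
  case (2 c u f b)
  have "\<bar>c * f (False # b)\<bar> \<le> \<bar>c\<bar> * B"
    using "2.prems" by (simp add: abs_mult mult_left_mono)
  moreover have "\<bar>wedge u (\<lambda>r. f (True # r)) b\<bar> \<le> (\<Sum>c\<leftarrow>u. \<bar>c\<bar>) * B"
    by (rule "2.IH") (rule "2.prems")
  ultimately show ?case by (simp add: distrib_right)
next
  case (3 f b) then show ?case by simp
next
  case (4 c u f)
  have "0 \<le> B" using "4.prems" abs_ge_zero order_trans by blast
  moreover have "0 \<le> (\<Sum>c\<leftarrow>u. \<bar>c\<bar>)" by (rule sum_list_nonneg) auto
  ultimately show ?case by simp
qed

text \<open>The 1 of the exterior algebra, i.e. the empty monomial. One definition serves all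
  dimensions, so it can be compared across them and split into two copies.\<close>

definition unit_ext :: "bool list \<Rightarrow> int" where
  "unit_ext b = of_bool (True \<notin> set b)"

definition powers :: "nat \<Rightarrow> int \<Rightarrow> int list" where
  "powers M v = map (\<lambda>i. v ^ i) [0..<M]"

text \<open>Its coefficients are minors of the matrix of powers, up to sign. For
  \<open>M = length w\<close> the coefficient of the full monomial is a Vandermonde
  determinant.\<close>

definition wedge_powers :: "nat \<Rightarrow> int list \<Rightarrow> bool list \<Rightarrow> int" where
  "wedge_powers M w = foldr (\<lambda>v. wedge (powers M v)) w unit_ext"

lemma length_powers [simp]: "length (powers M v) = M"
  by (simp add: powers_def)

lemma wedge_powers_simps [simp]:
  "wedge_powers M [] = unit_ext"
  "wedge_powers M (v # w) = wedge (powers M v) (wedge_powers M w)"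
  by (simp_all add: wedge_powers_def)

text \<open>Anticommutation moves the new vector next to its twin, where \<open>wedge_self\<close>
  applies.\<close>

lemma wedge_powers_mem: "v \<in> set w \<Longrightarrow> wedge (powers M v) (wedge_powers M w) = (\<lambda>b. 0)"
proof (induction w)
  case (Cons y w)
  show ?case
  proof (cases "v = y")
    case True then show ?thesis by (auto simp: wedge_self)
  next
    case False
    with Cons have *: "wedge (powers M v) (wedge_powers M w) = (\<lambda>b. 0)" by simp
    show ?thesis by (rule ext, simp add: wedge_anticommute[of "powers M v"] *)
  qed
qed simp

lemma wedge_powers_not_distinct: "\<not> distinct w \<Longrightarrow> wedge_powers M w = (\<lambda>b. 0)"
proof (induction w)
  case (Cons v w)
  then show ?case by (cases "v \<in> set w") (auto simp: wedge_powers_mem)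
qed simp

text \<open>Laplace expansion along the row \<open>u\<close>: the bit list with one
  \<open>False\<close> selects the complementary minor.\<close>

lemma wedge_top:
  "wedge u f (replicate (length u) True) =
    (\<Sum>i<length u. (-1) ^ i * u ! i * f ((replicate (length u) True)[i := False]))"
proof (induction u arbitrary: f)
  case (Cons c u)
  show ?case by (simp add: Cons.IH sum.lessThan_Suc_shift sum_negf del: sum.lessThan_Suc)
qed simp

text \<open>On monomials without the last basis vector, the last coordinate has no influence. This
  identifies the leading coefficient of a Vandermonde determinant with a determinant of one
  dimension less.\<close>

lemma wedge_snoc:
  "length b = length u \<Longrightarrow> wedge (u @ [c]) f (b @ [False]) = wedge u (\<lambda>r. f (r @ [False])) b"
proof (induction u arbitrary: b f)
  case (Cons d u)
  then obtain x b' where b: "b = x # b'" "length b' = length u" by (cases b) auto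
  show ?case by (cases x) (simp_all add: b Cons.IH)
qed simp

lemma wedge_powers_snoc:
  "length b = M \<Longrightarrow> wedge_powers (Suc M) w (b @ [False]) = wedge_powers M w b"
proof (induction w arbitrary: b)
  case Nil then show ?case by (simp add: unit_ext_def)
next
  case (Cons v w)
  have "wedge_powers (Suc M) (v # w) (b @ [False])
      = wedge (powers M v) (\<lambda>r. wedge_powers (Suc M) w (r @ [False])) b"
    using Cons.prems by (simp add: powers_def wedge_snoc)
  also have "\<dots> = wedge (powers M v) (wedge_powers M w) b"
    by (rule wedge_cong) (simp add: Cons)
  finally show ?case by simp
qed

text \<open>As a function of its first entry, a Vandermonde determinant is a polynomial whose leading
  coefficient is a smaller Vandermonde determinant and whose roots are the other entries.\<close>

lemma wedge_powers_distinct: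
  "distinct w \<Longrightarrow> wedge_powers (length w) w (replicate (length w) True) \<noteq> 0"
proof (induction w)
  case Nil then show ?case by (simp add: unit_ext_def)
next
  case (Cons v w)
  let ?m = "length w"
  define c where "c i = (-1) ^ i *
    wedge_powers (Suc ?m) w ((replicate (Suc ?m) True)[i := False])" for i
  have p: "wedge_powers (Suc ?m) (y # w) (replicate (Suc ?m) True) = (\<Sum>i\<le>?m. c i * y ^ i)" for y
    using wedge_top[of "powers (Suc ?m) y" "wedge_powers (Suc ?m) w"]
    by (simp add: c_def powers_def lessThan_Suc_atMost mult_ac
        del: sum.lessThan_Suc upt_Suc replicate_Suc)
  have "replicate (Suc ?m) True = replicate ?m True @ [True]"
    by (simp add: replicate_append_same)
  then have "(replicate (Suc ?m) True)[?m := False] = replicate ?m True @ [False]"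
    by (simp add: list_update_append del: replicate_Suc)
  then have lead: "c ?m \<noteq> 0"
    using Cons by (simp add: c_def wedge_powers_snoc)
  \<comment> \<open>The integer coefficients are read as real ones in order to use the bound on the
    number of roots of a polynomial.\<close>
  let ?R = "{y :: real. (\<Sum>i\<le>?m. real_of_int (c i) * y ^ i) = 0}"
  have roots: "finite ?R \<and> card ?R \<le> ?m"
    by (rule polyfun_rootbound[of _ ?m]) (use lead in auto)
  show ?case
  proof
    assume zero: "wedge_powers (length (v # w)) (v # w) (replicate (length (v # w)) True) = 0"
    \<comment> \<open>The entry \<open>v\<close> is a root by assumption, each entry of
      \<open>w\<close> because it repeats a factor. That makes one root more than the degree
      \<open>?m\<close> allows.\<close>
    have "real_of_int ` set (v # w) \<subseteq> ?R"
    proof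
      fix z assume "z \<in> real_of_int ` set (v # w)"
      then obtain y where y: "y \<in> set (v # w)" "z = real_of_int y" by auto
      then have "(\<Sum>i\<le>?m. c i * y ^ i) = 0"
        using zero p[of y] wedge_powers_mem[of y w "Suc ?m"] by auto
      then have "real_of_int (\<Sum>i\<le>?m. c i * y ^ i) = 0" by simp
      then show "z \<in> ?R" by (simp add: y)
    qed
    then have "card (real_of_int ` set (v # w)) \<le> ?m"
      using roots card_mono order_trans by blast
    then have "card (set (v # w)) \<le> ?m"
      by (subst (asm) card_image) (auto simp: inj_on_def)
    with Cons.prems show False by (simp add: distinct_card)
  qed
qed

text \<open>The grading of the algebra. It is needed to see that the signs arising from two copies
  do not depend on the monomial.\<close>

lemma wedge_degree:
  "(\<And>r. f r \<noteq> 0 \<Longrightarrow> count_list r True = m) \<Longrightarrow> wedge u f b \<noteq> 0 \<Longrightarrow> count_list b True = Suc m"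
proof (induction u f b arbitrary: m rule: wedge.induct)
  case (1 c u f b)
  have "count_list r True = m" if "f (False # r) \<noteq> 0" for r
    using "1.prems"(1)[OF that] by simp
  from "1.IH"[of m, OF this] "1.prems"(2) show ?case by simp
next
  case (2 c u f b)
  show ?case
  proof (cases "f (False # b) = 0")
    case False
    then show ?thesis using "2.prems"(1)[OF False] by simp
  next
    case True
    then have nz: "wedge u (\<lambda>r. f (True # r)) b \<noteq> 0" using "2.prems" by simp
    \<comment> \<open>A monomial of \<open>f\<close> that contains the first basis vector shows that
      \<open>m\<close> is positive, so that the induction hypothesis can be used for its
      predecessor.\<close>
    have "\<exists>r. f (True # r) \<noteq> 0"
    proof (rule ccontr)
      assume "\<nexists>r. f (True # r) \<noteq> 0"
      then have "(\<lambda>r. f (True # r)) = (\<lambda>r. 0)" by auto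
      with nz show False by simp
    qed
    then obtain m' where m: "m = Suc m'" using "2.prems"(1) by fastforce
    have "count_list r True = m'" if "f (True # r) \<noteq> 0" for r
      using "2.prems"(1)[OF that] m by simp
    from "2.IH"[of m', OF this nz] show ?thesis using m by simp
  qed
qed simp_all

lemma wedge_powers_degree: "wedge_powers M w b \<noteq> 0 \<Longrightarrow> count_list b True = length w"
proof (induction w arbitrary: b)
  case Nil
  then show ?case by (auto simp: unit_ext_def count_list_0_iff)
next
  case (Cons v w)
  then show ?case using wedge_degree[of "wedge_powers M w" "length w" "powers M v" b] by simp
qed

section \<open>Two copies of the exterior algebra\<close>

lemma wedge_tensor_left:
  "wedge (u @ replicate m 0) (\<lambda>b. f (take (length u) b) * g (drop (length u) b)) b
    = wedge u f (take (length u) b) * g (drop (length u) b)"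
proof (induction u arbitrary: f b)
  case Nil
  have "wedge (replicate m 0) h b = 0" for h b
  proof (induction m arbitrary: h b)
    case (Suc m)
    show ?case
    proof (cases b)
      case (Cons x b')
      then show ?thesis by (cases x) (simp_all add: Suc.IH)
    qed simp
  qed simp
  then show ?case by simp
next
  case (Cons c u)
  show ?case
  proof (cases b)
    case b: (Cons x b')
    show ?thesis
      using Cons.IH[of "\<lambda>r. f (x # r)" b']
      by (cases x) (simp_all add: b left_diff_distrib)
  qed simp
qed

text \<open>Earlier basis vectors are written further to the right, so a vector of the second copy,
  multiplied from the right, has to pass all factors from the first copy. Each of them contributes a
  factor -1.\<close>

lemma wedge_tensor_right:
  "length b \<ge> m \<Longrightarrow> wedge (replicate m 0 @ u) (\<lambda>b. f (take m b) * g (drop m b)) b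
    = (-1) ^ count_list (take m b) True * f (take m b) * wedge u g (drop m b)"
proof (induction m arbitrary: f b)
  case 0
  then show ?case by (simp add: wedge_scale)
next
  case (Suc m)
  then obtain x b' where b: "b = x # b'" "length b' \<ge> m" by (cases b) auto
  show ?case using Suc.IH[OF b(2), of "\<lambda>r. f (x # r)"] by (cases x) (simp_all add: b)
qed

text \<open>The vector of \<open>v\<close> enters once in each half of the \<open>2 * M\<close>
  coordinates. Both halves thus collect the same determinant.\<close>

definition vertex_step :: "nat \<Rightarrow> int \<Rightarrow> (bool list \<Rightarrow> int) \<Rightarrow> bool list \<Rightarrow> int" where
  "vertex_step M v f =
    wedge (replicate M 0 @ powers M v) (wedge (powers M v @ replicate M 0) f)"

lemma vertex_step_cong:
  "(\<And>r. length r = length b \<Longrightarrow> f r = g r) \<Longrightarrow> vertex_step M v f b = vertex_step M v g b"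
  unfolding vertex_step_def by (intro wedge_cong) auto

lemma vertex_step_sum:
  "vertex_step M v (\<lambda>b. \<Sum>i\<in>A. f i b) b = (\<Sum>i\<in>A. vertex_step M v (f i) b)"
  by (simp add: vertex_step_def wedge_sum)

text \<open>The sign only depends on the number of vertices, so that no two terms of the sum over all
  tuples cancel.\<close>

lemma vertex_steps_square:
  "\<exists>s :: int. s \<noteq> 0 \<and> (\<forall>w b. length w = m \<longrightarrow> length b = 2 * M \<longrightarrow>
     foldr (vertex_step M) w unit_ext b =
       s * (wedge_powers M w (take M b) * wedge_powers M w (drop M b)))"
proof (induction m)
  case 0
  have *: "unit_ext b = unit_ext (take M b) * unit_ext (drop M b)" for b
    using set_append[of "take M b" "drop M b"] by (auto simp: unit_ext_def simp del: set_append)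
  show ?case by (intro exI[of _ 1]) (simp flip: *)
next
  case (Suc m)
  then obtain s :: int where s: "s \<noteq> 0" and eq: "\<And>w b. length w = m \<Longrightarrow> length b = 2 * M \<Longrightarrow>
     foldr (vertex_step M) w unit_ext b =
       s * (wedge_powers M w (take M b) * wedge_powers M w (drop M b))" by blast
  show ?case
  proof (intro exI[of _ "s * (-1) ^ Suc m"] conjI allI impI)
    show "s * (-1) ^ Suc m \<noteq> 0" using s by simp
    fix w :: "int list" and b :: "bool list"
    assume w: "length w = Suc m" and b: "length b = 2 * M"
    then obtain v w' where w': "w = v # w'" "length w' = m" by (cases w) auto
    let ?f = "wedge_powers M w'"
    have "foldr (vertex_step M) w unit_ext b
        = vertex_step M v (\<lambda>b. s * (?f (take M b) * ?f (drop M b))) b"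
      unfolding w' foldr.simps comp_def by (rule vertex_step_cong) (simp add: eq w' b)
    also have "\<dots> = s * wedge (replicate M 0 @ powers M v)
        (\<lambda>b. wedge (powers M v) ?f (take M b) * ?f (drop M b)) b"
      using wedge_tensor_left[of "powers M v" M ?f ?f, unfolded length_powers]
      by (simp add: vertex_step_def wedge_scale)
    also have "\<dots> = s * ((-1) ^ count_list (take M b) True * wedge (powers M v) ?f (take M b)
        * wedge (powers M v) ?f (drop M b))"
      by (subst wedge_tensor_right) (simp_all add: b)
    \<comment> \<open>Here the sign becomes constant: a nonzero coefficient forces the first half to
      have degree \<open>Suc m\<close>, and for a zero coefficient both sides vanish.\<close>
    also have "(-1) ^ count_list (take M b) True * wedge (powers M v) ?f (take M b)
        = (-1) ^ Suc m * wedge (powers M v) ?f (take M b)"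
      using wedge_powers_degree[of M "v # w'" "take M b"] w'
      by (cases "wedge (powers M v) ?f (take M b) = 0") simp_all
    finally show "foldr (vertex_step M) w unit_ext b =
        s * (-1) ^ Suc m * (wedge_powers M w (take M b) * wedge_powers M w (drop M b))"
      by (simp add: w' mult.assoc)
  qed
qed

lemma vertex_steps_top:
  obtains s :: int where "s \<noteq> 0" and
    "\<And>w. length w = M \<Longrightarrow> foldr (vertex_step M) w unit_ext (replicate (2 * M) True) =
       s * (wedge_powers M w (replicate M True))\<^sup>2"
proof -
  from vertex_steps_square[of M M] obtain s :: int where s: "s \<noteq> 0"
    and eq: "\<And>w b. length w = M \<Longrightarrow> length b = 2 * M \<Longrightarrow>
     foldr (vertex_step M) w unit_ext b =
       s * (wedge_powers M w (take M b) * wedge_powers M w (drop M b))" by blast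
  show ?thesis
    by (rule that[OF s]) (simp add: eq power2_eq_square min_def)
qed

section \<open>Detecting consistent matchings\<close>

type_synonym edge = "nat \<times> nat"

definition ends :: "edge \<Rightarrow> nat set" where
  "ends e = {fst e, snd e}"

definition edge_step :: "nat \<Rightarrow> edge \<Rightarrow> (bool list \<Rightarrow> int) \<Rightarrow> bool list \<Rightarrow> int" where
  "edge_step M e f = vertex_step M (int (fst e)) (vertex_step M (int (snd e)) f)"

definition edges_step :: "nat \<Rightarrow> edge list \<Rightarrow> (bool list \<Rightarrow> int) \<Rightarrow> bool list \<Rightarrow> int" where
  "edges_step M E f b = (\<Sum>e\<leftarrow>E. edge_step M e f b)"

definition endpoints :: "edge list \<Rightarrow> nat list" where
  "endpoints w = concat (map (\<lambda>e. [fst e, snd e]) w)"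

lemma endpoints_simps [simp]:
  "endpoints [] = []" "endpoints (e # w) = fst e # snd e # endpoints w"
  by (simp_all add: endpoints_def)

lemma length_endpoints [simp]: "length (endpoints w) = 2 * length w"
  by (induction w) auto

lemma set_endpoints: "set (endpoints w) = \<Union> (ends ` set w)"
  by (induction w) (auto simp: ends_def)

text \<open>\<open>disjoint\<close> compares only different members of a set, so it cannot see an
  edge that occurs twice in the tuple; \<open>distinct (map ends w)\<close> accounts for
  that.\<close>

lemma distinct_endpoints:
  "distinct (endpoints w) \<longleftrightarrow>
    (\<forall>e\<in>set w. fst e \<noteq> snd e) \<and> distinct (map ends w) \<and> disjoint (ends ` set w)"
proof (induction w)
  case (Cons e w)
  have meet: "ends e \<inter> \<Union> (ends ` set w) = {} \<longleftrightarrow> (\<forall>f\<in>set w. ends e \<inter> ends f = {})"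
    by (simp only: Int_Union SUP_bot_conv image_image)
  have ne: "(ends e \<inter> ends f = {}) = (ends e \<noteq> ends f \<and> disjnt (ends e) (ends f))" for f
    by (auto simp: ends_def disjnt_def)
  have "distinct (endpoints (e # w)) \<longleftrightarrow>
      fst e \<noteq> snd e \<and> ends e \<inter> \<Union> (ends ` set w) = {} \<and> distinct (endpoints w)"
    unfolding endpoints_simps distinct.simps list.set set_endpoints by (simp add: ends_def)
  moreover have "disjoint (ends ` set (e # w)) \<longleftrightarrow>
      (\<forall>f\<in>set w. ends e \<noteq> ends f \<longrightarrow> disjnt (ends e) (ends f)) \<and> disjoint (ends ` set w)"
    by (auto simp: pairwise_insert disjnt_def Int_commute)
  moreover have "distinct (map ends (e # w)) \<longleftrightarrow>
      (\<forall>f\<in>set w. ends e \<noteq> ends f) \<and> distinct (map ends w)"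
    by auto
  ultimately show ?case
    unfolding meet ne Cons.IH by (simp only: list.set ball_simps) blast
qed simp

lemma foldr_edge_step:
  "foldr (edge_step M) w f = foldr (vertex_step M) (map int (endpoints w)) f"
  by (induction w) (auto simp: edge_step_def)

lemma edge_step_sum:
  "edge_step M e (\<lambda>b. \<Sum>i\<in>A. f i b) b = (\<Sum>i\<in>A. edge_step M e (f i) b)"
proof -
  have "vertex_step M v (\<lambda>b. \<Sum>i\<in>A. f i b) = (\<lambda>b. \<Sum>i\<in>A. vertex_step M v (f i) b)" for v f
    by (rule ext) (rule vertex_step_sum)
  then show ?thesis by (simp add: edge_step_def)
qed

text \<open>Distributivity: a power of a sum of linear operators has one term per word. The
  right-hand side has exponentially many terms, the left-hand side takes only
  \<open>j * length E\<close> edge steps.\<close>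

lemma edges_step_power:
  assumes "distinct E"
  shows "(edges_step M E ^^ j) unit_ext b =
    (\<Sum>w | set w \<subseteq> set E \<and> length w = j. foldr (edge_step M) w unit_ext b)"
proof (induction j arbitrary: b)
  case 0
  have "{w. set w \<subseteq> set E \<and> length w = 0} = {[]}" by auto
  then show ?case by simp
next
  case (Suc j)
  let ?A = "{w. set w \<subseteq> set E \<and> length w = j}"
  have "(edges_step M E ^^ Suc j) unit_ext b = (\<Sum>e\<in>set E. edge_step M e ((edges_step M E ^^ j) unit_ext) b)"
    using assms by (simp add: edges_step_def sum_list_distinct_conv_sum_set)
  also have "(edges_step M E ^^ j) unit_ext = (\<lambda>b. \<Sum>w\<in>?A. foldr (edge_step M) w unit_ext b)"
    by (rule ext) (rule Suc)
  also have "(\<Sum>e\<in>set E. edge_step M e (\<lambda>b. \<Sum>w\<in>?A. foldr (edge_step M) w unit_ext b) b)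
      = (\<Sum>w\<in>?A. \<Sum>e\<in>set E. foldr (edge_step M) (e # w) unit_ext b)"
    by (subst sum.swap) (simp add: edge_step_sum)
  also have "\<dots> = (\<Sum>(w, e)\<in>?A \<times> set E. foldr (edge_step M) (e # w) unit_ext b)"
    by (rule sum.cartesian_product)
  also have "\<dots> = (\<Sum>w\<in>(\<lambda>(w, e). e # w) ` (?A \<times> set E). foldr (edge_step M) w unit_ext b)"
    by (subst sum.reindex) (auto simp: inj_on_def intro!: sum.cong)
  also have "(\<lambda>(w, e). e # w) ` (?A \<times> set E) = {w. set w \<subseteq> set E \<and> length w = Suc j}"
    by (rule lists_length_Suc_eq[symmetric])
  finally show ?case .
qed

text \<open>Compared via \<open>ends\<close>, since a sample may list an edge in the opposite
  orientation.\<close>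

definition common_edges :: "edge list \<Rightarrow> edge list \<Rightarrow> edge list" where
  "common_edges E P = filter (\<lambda>e. ends e \<in> ends ` set P) E"

text \<open>Inclusion-exclusion written as a recursion: the tuples leaving \<open>P\<close> are all
  tuples minus those inside \<open>P\<close>. Only this clause makes two calls. The base case reads
  off the full monomial of both copies, of dimension \<open>2 * k\<close> each.\<close>

fun score :: "nat \<Rightarrow> edge list \<Rightarrow> (edge list \<times> bool) list \<Rightarrow> int" where
  "score k E [] = (edges_step (2 * k) E ^^ k) unit_ext (replicate (4 * k) True)"
| "score k E ((P, l) # S) =
    (if l then score k (common_edges E P) S else score k E S - score k (common_edges E P) S)"

definition weight :: "nat \<Rightarrow> edge list \<Rightarrow> int" where
  "weight k w = foldr (edge_step (2 * k)) w unit_ext (replicate (4 * k) True)"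

text \<open>The consistency condition with disjointness left out; for disjoint \<open>F\<close> the
  two agree.\<close>

definition labelled :: "nat set set \<Rightarrow> (edge list \<times> bool) list \<Rightarrow> bool" where
  "labelled F S \<longleftrightarrow> (\<forall>(P, l)\<in>set S. F \<subseteq> ends ` set P \<longleftrightarrow> l)"

lemma finite_tuples: "finite {w. set w \<subseteq> set E \<and> length w = k \<and> Q w}"
  by (rule finite_subset[OF _ finite_lists_length_eq[of "set E" k]]) auto

text \<open>A tuple over \<open>common_edges E P\<close> is a tuple over \<open>E\<close> contained
  in \<open>P\<close>, so restricting the edge list is intersecting the index set, and the
  subtraction is the sum over a set difference.\<close>

lemma score_eq_sum:
  "distinct E \<Longrightarrow> score k E S =
    (\<Sum>w | set w \<subseteq> set E \<and> length w = k \<and> labelled (ends ` set w) S. weight k w)"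
proof (induction S arbitrary: E)
  case Nil
  then show ?case by (simp add: edges_step_power weight_def labelled_def)
next
  case (Cons s S)
  obtain P l where s: "s = (P, l)" by (cases s)
  let ?A = "\<lambda>E S. {w. set w \<subseteq> set E \<and> length w = k \<and> labelled (ends ` set w) S}"
  have common: "?A (common_edges E P) S = {w \<in> ?A E S. ends ` set w \<subseteq> ends ` set P}"
    by (auto simp: common_edges_def)
  have IH: "score k E S = sum (weight k) (?A E S)"
    "score k (common_edges E P) S = sum (weight k) (?A (common_edges E P) S)"
    using Cons by (simp_all add: common_edges_def)
  show ?case
  proof (cases l)
    case True
    have "?A (common_edges E P) S = ?A E (s # S)"
      unfolding common s using True by (auto simp: labelled_def)
    then show ?thesis using True IH by (simp add: s)
  next
    case False
    have "?A E (s # S) = ?A E S - ?A (common_edges E P) S"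
      unfolding common s using False by (auto simp: labelled_def)
    moreover have "sum (weight k) (?A E S - ?A (common_edges E P) S)
        = sum (weight k) (?A E S) - sum (weight k) (?A (common_edges E P) S)"
      by (rule sum_diff) (use finite_tuples[of E k] in \<open>auto simp: common\<close>)
    ultimately show ?thesis using False IH by (simp add: s)
  qed
qed

lemma weight_square:
  obtains s :: int where "s \<noteq> 0" and
    "\<And>w. length w = k \<Longrightarrow> weight k w =
      s * (wedge_powers (2 * k) (map int (endpoints w)) (replicate (2 * k) True))\<^sup>2"
proof -
  obtain s :: int where s: "s \<noteq> 0" and
    "\<And>w. length w = 2 * k \<Longrightarrow>
      foldr (vertex_step (2 * k)) w unit_ext (replicate (2 * (2 * k)) True) =
       s * (wedge_powers (2 * k) w (replicate (2 * k) True))\<^sup>2"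
    using vertex_steps_top[of "2 * k"] by metis
  then show ?thesis
    by (intro that[OF s]) (simp add: weight_def foldr_edge_step)
qed

text \<open>The factor \<open>s\<close> is common to all tuples of length \<open>k\<close>. Pulled
  out, it leaves a sum of squares of integers, which vanishes only termwise.\<close>

lemma score_nonzero_tuple:
  assumes "distinct E"
  shows "score k E S \<noteq> 0 \<longleftrightarrow>
    (\<exists>w. set w \<subseteq> set E \<and> length w = k \<and> labelled (ends ` set w) S \<and> distinct (endpoints w))"
proof -
  let ?d = "\<lambda>w. wedge_powers (2 * k) (map int (endpoints w)) (replicate (2 * k) True)"
  let ?A = "{w. set w \<subseteq> set E \<and> length w = k \<and> labelled (ends ` set w) S}"
  obtain s :: int where s: "s \<noteq> 0" "\<And>w. length w = k \<Longrightarrow> weight k w = s * (?d w)\<^sup>2"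
    using weight_square[of k] by blast
  have d: "?d w \<noteq> 0 \<longleftrightarrow> distinct (endpoints w)" if "length w = k" for w
  proof -
    have "distinct (map int (endpoints w)) = distinct (endpoints w)"
      by (simp add: distinct_map)
    then show ?thesis
      using wedge_powers_distinct[of "map int (endpoints w)"]
        wedge_powers_not_distinct[of "map int (endpoints w)" "2 * k"] that by auto
  qed
  have "score k E S = (\<Sum>w\<in>?A. s * (?d w)\<^sup>2)"
    unfolding score_eq_sum[OF assms] by (rule sum.cong) (auto simp: s)
  also have "\<dots> = s * (\<Sum>w\<in>?A. (?d w)\<^sup>2)" by (simp add: sum_distrib_left)
  finally have "score k E S = 0 \<longleftrightarrow> (\<forall>w\<in>?A. (?d w)\<^sup>2 = 0)"
    using s(1) finite_tuples[of E k] by (simp add: sum_nonneg_eq_0_iff)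
  then show ?thesis using d by auto
qed

definition solution :: "nat \<Rightarrow> edge list \<Rightarrow> (edge list \<times> bool) list \<Rightarrow> nat set set \<Rightarrow> bool" where
  "solution k E S F \<longleftrightarrow> F \<subseteq> ends ` set E \<and> card F = k \<and> disjoint F \<and> labelled F S"

lemma score_nonzero_iff:
  assumes "distinct E" and ne: "\<And>e. e \<in> set E \<Longrightarrow> fst e \<noteq> snd e"
  shows "score k E S \<noteq> 0 \<longleftrightarrow> (\<exists>F. solution k E S F)"
proof
  assume "score k E S \<noteq> 0"
  then obtain w where w: "set w \<subseteq> set E" "length w = k" "labelled (ends ` set w) S"
    "distinct (endpoints w)" using score_nonzero_tuple[OF assms(1)] by blast
  then have "distinct (map ends w)" "disjoint (ends ` set w)"
    by (simp_all add: distinct_endpoints)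
  with w have "solution k E S (ends ` set w)"
    unfolding solution_def by (metis distinct_card image_mono image_set length_map)
  then show "\<exists>F. solution k E S F" ..
next
  assume "\<exists>F. solution k E S F"
  then obtain F where F: "F \<subseteq> ends ` set E" "card F = k" "disjoint F" "labelled F S"
    by (auto simp: solution_def)
  obtain fs where fs: "set fs = F" "distinct fs"
    using finite_distinct_list[of F] F(1) finite_subset by blast
  \<comment> \<open>The inverse picks, for each edge of \<open>F\<close>, one oriented
    representative from the list \<open>E\<close>.\<close>
  define w where "w = map (inv_into (set E) ends) fs"
  have ends: "map ends w = fs"
    using F(1) fs(1) unfolding w_def by (auto simp: f_inv_into_f intro!: map_idI)
  have w: "set w \<subseteq> set E"
    using F(1) fs(1) by (auto simp: w_def intro!: inv_into_into)
  have F': "ends ` set w = F" using ends fs(1) by (metis image_set)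
  have "length w = k" using ends F(2) fs by (metis distinct_card length_map)
  moreover have "distinct (endpoints w)"
    using w ne F(3) fs(2) by (auto simp: distinct_endpoints ends F')
  ultimately show "score k E S \<noteq> 0"
    using w F(4) score_nonzero_tuple[OF assms(1)] F' by blast
qed

section \<open>Size of the score\<close>

lemma sum_powers_le:
  fixes v B :: int
  assumes "0 \<le> v" "v < B" "2 \<le> B"
  shows "(\<Sum>c\<leftarrow>powers M v. \<bar>c\<bar>) \<le> B ^ M"
proof (induction M)
  case (Suc M)
  have "v ^ M \<le> B ^ M" using assms by (intro power_mono) auto
  then have "(\<Sum>c\<leftarrow>powers (Suc M) v. \<bar>c\<bar>) \<le> 2 * B ^ M"
    using Suc assms by (simp add: powers_def)
  also have "\<dots> \<le> B * B ^ M" using assms by (intro mult_right_mono) auto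
  finally show ?case by simp
qed (simp add: powers_def)

lemma vertex_step_bound:
  assumes "0 \<le> v" "v < B" "2 \<le> B" and "\<And>r. \<bar>f r\<bar> \<le> C"
  shows "\<bar>vertex_step M v f b\<bar> \<le> B ^ (2 * M) * C"
proof -
  have C: "0 \<le> C" using assms(4) abs_ge_zero order_trans by blast
  have s: "(\<Sum>c\<leftarrow>powers M v @ replicate M 0. \<bar>c\<bar>) \<le> B ^ M"
    "(\<Sum>c\<leftarrow>replicate M 0 @ powers M v. \<bar>c\<bar>) \<le> B ^ M"
    using sum_powers_le[OF assms(1-3), of M] by (simp_all add: sum_list_replicate)
  have "\<bar>wedge (powers M v @ replicate M 0) f r\<bar> \<le> B ^ M * C" for r
    using wedge_bound[of f C "powers M v @ replicate M 0" r, OF assms(4)] mult_right_mono[OF s(1) C]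
    by (rule order_trans)
  from wedge_bound[of _ _ "replicate M 0 @ powers M v" b, OF this]
  have "\<bar>vertex_step M v f b\<bar> \<le> (\<Sum>c\<leftarrow>replicate M 0 @ powers M v. \<bar>c\<bar>) * (B ^ M * C)"
    by (simp only: vertex_step_def)
  also have "\<dots> \<le> B ^ M * (B ^ M * C)"
    using s(2) C assms(3) by (intro mult_right_mono) auto
  finally show ?thesis by (simp add: mult_2 power_add mult.assoc)
qed

lemma vertex_steps_bound:
  assumes "2 \<le> B" and "\<And>v. v \<in> set w \<Longrightarrow> 0 \<le> v \<and> v < B"
  shows "\<bar>foldr (vertex_step M) w unit_ext b\<bar> \<le> B ^ (2 * M * length w)"
  using assms(2)
proof (induction w arbitrary: b)
  case (Cons v w)
  have "\<bar>vertex_step M v (foldr (vertex_step M) w unit_ext) b\<bar>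
      \<le> B ^ (2 * M) * B ^ (2 * M * length w)"
    by (rule vertex_step_bound) (use Cons assms(1) in auto)
  then show ?case by (simp add: power_add)
qed (simp add: unit_ext_def)

text \<open>With \<open>M = 2 * k\<close>, each of the \<open>2 * k\<close> vertices of a tuple
  costs a factor \<open>B ^ (4 * k)\<close>, and there are at most \<open>(B ^ 2) ^ k\<close>
  tuples. The final \<open>+ 1\<close> makes the bound strict, so that the power can serve as
  modulus.\<close>

lemma score_bound:
  assumes "distinct E" "2 \<le> B" "length E \<le> B ^ 2"
    and B: "\<And>e. e \<in> set E \<Longrightarrow> fst e < B \<and> snd e < B"
  shows "\<bar>score k E S\<bar> < int (B ^ (8 * k * k + 2 * k + 1))"
proof -
  let ?A = "{w. set w \<subseteq> set E \<and> length w = k \<and> labelled (ends ` set w) S}"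
  let ?T = "{w. set w \<subseteq> set E \<and> length w = k}"
  have w: "\<bar>weight k w\<bar> \<le> int B ^ (8 * k * k)" if "w \<in> ?A" for w
  proof -
    have v: "0 \<le> v \<and> v < int B" if "v \<in> set (map int (endpoints w))" for v
      using that B \<open>w \<in> ?A\<close> by (fastforce simp: set_endpoints ends_def)
    have "\<bar>weight k w\<bar> \<le> int B ^ (2 * (2 * k) * length (map int (endpoints w)))"
      unfolding weight_def foldr_edge_step
      by (rule vertex_steps_bound) (use assms(2) v in auto)
    with \<open>w \<in> ?A\<close> show ?thesis by (simp add: mult_ac)
  qed
  have "\<bar>score k E S\<bar> \<le> (\<Sum>w\<in>?A. \<bar>weight k w\<bar>)"
    unfolding score_eq_sum[OF assms(1)] by (rule sum_abs)
  also have "\<dots> \<le> (\<Sum>w\<in>?A. int B ^ (8 * k * k))" by (rule sum_mono) (rule w)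
  also have "\<dots> = int (card ?A) * int B ^ (8 * k * k)" by simp
  also have "card ?A \<le> card ?T"
    by (rule card_mono) (use finite_lists_length_eq[of "set E" k] in auto)
  also have "card ?T = length E ^ k"
    using assms(1) by (simp add: card_lists_length_eq distinct_card)
  also have "\<dots> \<le> (B ^ 2) ^ k" using assms(3) by (rule power_mono) simp
  finally have "\<bar>score k E S\<bar> \<le> int ((B ^ 2) ^ k * B ^ (8 * k * k))"
    by (simp add: mult_right_mono)
  also have "(B ^ 2) ^ k * B ^ (8 * k * k) = B ^ (8 * k * k + 2 * k)"
    by (simp add: power_add flip: power_mult)
  also have "int (B ^ (8 * k * k + 2 * k)) < int (B ^ (8 * k * k + 2 * k + 1))"
    using assms(2) by (simp del: of_nat_power)
  finally show ?thesis .
qed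

section \<open>Self-reduction: from detecting to finding a solution\<close>

fun prune :: "nat \<Rightarrow> (edge list \<times> bool) list \<Rightarrow> edge list \<Rightarrow> edge list \<Rightarrow> edge list" where
  "prune k S kept [] = kept"
| "prune k S kept (e # todo) =
    (if score k (kept @ todo) S \<noteq> 0 then prune k S kept todo else prune k S (e # kept) todo)"

lemma prune_solution:
  assumes "distinct (map ends (kept @ todo))"
    and "\<And>e. e \<in> set (kept @ todo) \<Longrightarrow> fst e \<noteq> snd e"
    and "\<exists>F. solution k (kept @ todo) S F"
    and "\<And>e F. e \<in> set kept \<Longrightarrow> solution k (kept @ todo) S F \<Longrightarrow> ends e \<in> F"
  shows "solution k (prune k S kept todo) S (ends ` set (prune k S kept todo)) \<and>
    distinct (map ends (prune k S kept todo))"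
  using assms
proof (induction todo arbitrary: kept)
  case Nil
  then obtain F where F: "solution k kept S F" by auto
  then have "F = ends ` set kept"
    using Nil.prems(4)[of _ F] by (auto simp: solution_def)
  with F Nil.prems(1) show ?case by simp
next
  case (Cons e todo)
  have iff: "score k (kept @ todo) S \<noteq> 0 \<longleftrightarrow> (\<exists>F. solution k (kept @ todo) S F)"
    by (rule score_nonzero_iff) (use Cons.prems(1,2) in \<open>auto simp: distinct_map\<close>)
  have mono: "solution k (kept @ e # todo) S F" if "solution k (kept @ todo) S F" for F
    using that by (auto simp: solution_def)
  show ?case
  proof (cases "score k (kept @ todo) S = 0")
    case False
    have "solution k (prune k S kept todo) S (ends ` set (prune k S kept todo)) \<and>
        distinct (map ends (prune k S kept todo))"
    proof (rule Cons.IH)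
      show "\<exists>F. solution k (kept @ todo) S F" using False iff by simp
      show "ends e' \<in> F" if "e' \<in> set kept" "solution k (kept @ todo) S F" for e' F
        using Cons.prems(4) that mono by blast
    qed (use Cons.prems(1,2) in auto)
    with False show ?thesis by simp
  next
    case True
    have same: "solution k ((e # kept) @ todo) S F \<longleftrightarrow> solution k (kept @ e # todo) S F" for F
      by (auto simp: solution_def)
    have "solution k (prune k S (e # kept) todo) S (ends ` set (prune k S (e # kept) todo)) \<and>
        distinct (map ends (prune k S (e # kept) todo))"
    proof (rule Cons.IH)
      show "\<exists>F. solution k ((e # kept) @ todo) S F" using Cons.prems(3) by (simp only: same)
      show "ends e' \<in> F" if "e' \<in> set (e # kept)" "solution k ((e # kept) @ todo) S F" for e' F
      proof (cases "e' = e")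
        case e: True
        show ?thesis
        proof (rule ccontr)
          assume "ends e' \<notin> F"
          then have "solution k (kept @ todo) S F"
            using that(2) e by (auto simp: solution_def)
          with True iff show False by blast
        qed
      next
        case False
        then show ?thesis using that same Cons.prems(4) by auto
      qed
    qed (use Cons.prems(1,2) in auto)
    with True show ?thesis by simp
  qed
qed

fun pairs :: "nat list \<Rightarrow> edge list" where
  "pairs [] = []"
| "pairs (v # V) = map (Pair v) V @ pairs V"

lemma set_pairs_subset: "e \<in> set (pairs V) \<Longrightarrow> fst e \<in> set V \<and> snd e \<in> set V"
  by (induction V) auto

lemma pairs_ne: "distinct V \<Longrightarrow> e \<in> set (pairs V) \<Longrightarrow> fst e \<noteq> snd e"
  by (induction V) auto

lemma ends_pairs: "distinct V \<Longrightarrow> ends ` set (pairs V) = [set V]\<^bsup>2\<^esup>"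
proof (induction V)
  case Nil
  then show ?case by (auto simp: nsets_def)
next
  case (Cons v V)
  have "[set (v # V)]\<^bsup>2\<^esup> = (\<lambda>w. {v, w}) ` set V \<union> [set V]\<^bsup>2\<^esup>"
    using Cons.prems by (auto simp: nsets_2_eq insert_commute)
  with Cons show ?case by (simp add: image_Un image_image ends_def)
qed

lemma distinct_pairs: "distinct V \<Longrightarrow> distinct (map ends (pairs V))"
proof (induction V)
  case (Cons v V)
  have "distinct (map (\<lambda>w. {v, w}) V)"
    using Cons.prems by (auto simp: distinct_map inj_on_def doubleton_eq_iff)
  moreover have "v \<notin> ends e" if "e \<in> set (pairs V)" for e
    using set_pairs_subset[OF that] Cons.prems by (auto simp: ends_def)
  ultimately show ?case using Cons by (auto simp: ends_def comp_def)
qed simp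

lemma length_pairs_le: "length (pairs V) \<le> (length V) ^ 2"
  by (induction V) (auto simp: power2_eq_square)

definition consistent :: "nat list \<Rightarrow> (edge list \<times> bool) list \<Rightarrow> nat \<Rightarrow> nat set set \<Rightarrow> bool" where
  "consistent V S k F \<longleftrightarrow> F \<subseteq> [set V]\<^bsup>2\<^esup> \<and> card F = k \<and>
    (\<forall>(P, l)\<in>set S. (F \<subseteq> ends ` set P \<and> disjoint F) \<longleftrightarrow> l)"

definition solve :: "nat list \<Rightarrow> (edge list \<times> bool) list \<Rightarrow> nat \<Rightarrow> edge list option" where
  "solve V S k =
    (if \<not> (\<exists>s\<in>set S. snd s) \<and> 1 < k \<and> k \<le> length (pairs V) then Some (take k (pairs V))
     else if score k (pairs V) S \<noteq> 0 then Some (prune k S [] (pairs V)) else None)"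

text \<open>Each alternative of \<open>ns\<close> forces disjointness: a positive sample demands it,
  at most one edge is trivially disjoint, and with too few pairs there is no candidate at
  all.\<close>

lemma consistent_iff_solution:
  assumes V: "distinct V" and ns: "(\<exists>s\<in>set S. snd s) \<or> k \<le> 1 \<or> length (pairs V) < k"
  shows "consistent V S k F \<longleftrightarrow> solution k (pairs V) S F"
proof -
  have fin: "finite ([set V]\<^bsup>2\<^esup>)" by (simp add: finite_imp_finite_nsets)
  have card: "card ([set V]\<^bsup>2\<^esup>) = length (pairs V)"
    using distinct_card[OF distinct_pairs[OF V]] ends_pairs[OF V] by simp
  have dj: "disjoint F" if F: "F \<subseteq> [set V]\<^bsup>2\<^esup>" "card F = k" "k \<le> 1"
  proof -
    have "finite F" using F fin finite_subset by blast
    with F(2,3) show ?thesis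
      by (intro disjointI) (metis card_le_Suc0_iff_eq One_nat_def)
  qed
  have big: "\<not> (F \<subseteq> [set V]\<^bsup>2\<^esup> \<and> card F = k)" if "length (pairs V) < k"
    using card_mono[OF fin, of F] card that by auto
  have "disjoint F" if "consistent V S k F"
  proof (cases "\<exists>s\<in>set S. snd s")
    case True
    then obtain P where P: "(P, True) \<in> set S" by auto
    have "\<forall>(P, l)\<in>set S. (F \<subseteq> ends ` set P \<and> disjoint F) \<longleftrightarrow> l"
      using that unfolding consistent_def by (elim conjE)
    from bspec[OF this P] show ?thesis by simp
  next
    case False
    have "F \<subseteq> [set V]\<^bsup>2\<^esup>" "card F = k" using that by (auto simp: consistent_def)
    with False ns dj big show ?thesis by blast
  qed
  moreover have "disjoint F" if "solution k (pairs V) S F"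
    using that by (simp add: solution_def)
  moreover have "consistent V S k F \<longleftrightarrow> solution k (pairs V) S F" if "disjoint F"
    using that by (simp add: consistent_def solution_def labelled_def ends_pairs[OF V])
  ultimately show ?thesis by blast
qed

lemma solve_correct:
  assumes V: "distinct V"
  shows "case solve V S k of None \<Rightarrow> \<not> (\<exists>F. consistent V S k F)
    | Some R \<Rightarrow> consistent V S k (ends ` set R) \<and> distinct (map ends R)"
proof (cases "\<not> (\<exists>s\<in>set S. snd s) \<and> 1 < k \<and> k \<le> length (pairs V)")
  case True
  let ?R = "take k (pairs V)"
  have d: "distinct (map ends ?R)"
    using distinct_pairs[OF V] by (simp add: take_map[symmetric])
  have "card (ends ` set ?R) = k"
    using distinct_card[OF d] True by simp
  moreover have "ends ` set ?R \<subseteq> [set V]\<^bsup>2\<^esup>"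
    unfolding ends_pairs[OF V, symmetric] by (intro image_mono set_take_subset)
  moreover have "\<not> disjoint (ends ` set ?R)"
  proof -
    \<comment> \<open>Two pairs require three vertices, and the list of pairs then starts with two
      pairs that share the first vertex. They violate disjointness, so every negative sample is
      satisfied.\<close>
    obtain a b c V' where abc: "V = a # b # c # V'"
    proof -
      have "2 \<le> length (pairs V)" using True by linarith
      then show ?thesis
        by (cases V; cases "tl V"; cases "tl (tl V)") (auto intro: that)
    qed
    obtain j where k: "k = Suc (Suc j)" using True by (cases k; cases "k - 1") auto
    have "{a, b} \<in> ends ` set ?R" "{a, c} \<in> ends ` set ?R"
      by (auto simp: abc k ends_def)
    moreover have "{a, b} \<noteq> {a, c}" using V abc by (auto simp: doubleton_eq_iff)
    ultimately show ?thesis using disjointD[of _ "{a, b}" "{a, c}"] by blast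
  qed
  ultimately have "consistent V S k (ends ` set ?R)"
    using True by (auto simp: consistent_def)
  then show ?thesis using True d by (simp add: solve_def)
next
  case False
  have eq: "consistent V S k F \<longleftrightarrow> solution k (pairs V) S F" for F
    by (rule consistent_iff_solution[OF V]) (use False in auto)
  have iff: "score k (pairs V) S \<noteq> 0 \<longleftrightarrow> (\<exists>F. solution k (pairs V) S F)"
    by (rule score_nonzero_iff) (use distinct_pairs[OF V] pairs_ne[OF V] in \<open>auto simp: distinct_map\<close>)
  show ?thesis
  proof (cases "score k (pairs V) S = 0")
    case True
    with iff eq False show ?thesis by (auto simp: solve_def)
  next
    case nz: False
    let ?R = "prune k S [] (pairs V)"
    have R: "solution k ?R S (ends ` set ?R) \<and> distinct (map ends ?R)"
      by (rule prune_solution) (use distinct_pairs[OF V] pairs_ne[OF V] nz iff in auto)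
    \<comment> \<open>A solution among the pruned edges has to be one among all pairs.\<close>
    have sub: "set (prune k S kept todo) \<subseteq> set (kept @ todo)" for kept todo
    proof (induction todo arbitrary: kept)
      case (Cons e todo)
      show ?case using Cons.IH[of kept] Cons.IH[of "e # kept"] by auto
    qed simp
    have "solution k (pairs V) S (ends ` set ?R)"
      using R sub[of "[]" "pairs V"] by (auto simp: solution_def)
    with R eq False nz show ?thesis by (auto simp: solve_def)
  qed
qed

section \<open>Bit lengths of arithmetic results\<close>

lemma bit_length_le:
  assumes "m < 2 ^ Z" "0 < Z"
  shows "bit_length m \<le> Z"
proof (cases "m = 0")
  case False
  then have "2 ^ floor_log m < (2 :: nat) ^ Z"
    using floor_log_exp2_le[of m] assms(1) by (meson le_less_trans neq0_conv)
  then have "floor_log m < Z" by (rule power_less_imp_less_exp[rotated]) simp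
  then show ?thesis by (simp add: bit_length_def)
qed (use assms in \<open>simp add: bit_length_def\<close>)

lemma less_bit_length: "m < 2 ^ bit_length m"
  using floor_log_exp2_gt[of m] by (simp add: bit_length_def)

lemma bit_length_pos [simp]: "0 < bit_length m" "Suc 0 \<le> bit_length m"
  by (simp_all add: bit_length_def)

lemma bit_length_mono: "m \<le> n \<Longrightarrow> bit_length m \<le> bit_length n"
  by (simp add: bit_length_def floor_log_le_iff)

lemma bit_length_mult: "bit_length (m * n) \<le> bit_length m + bit_length n"
  by (rule bit_length_le) (simp_all add: power_add mult_strict_mono' less_bit_length)

lemma bit_length_add: "bit_length (m + n) \<le> bit_length m + bit_length n"
proof (rule bit_length_le)
  have "(2 :: nat) ^ 1 \<le> 2 ^ bit_length x" for x
    by (rule power_increasing) simp_all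
  then have *: "2 ^ bit_length m \<ge> (2 :: nat)" "2 ^ bit_length n \<ge> (2 :: nat)" by simp_all
  have "a + b \<le> a * b" if "a \<ge> 2" "b \<ge> 2" for a b :: nat
    using that by (induction a rule: dec_induct) auto
  from this[OF *] show "m + n < 2 ^ (bit_length m + bit_length n)"
    using less_bit_length[of m] less_bit_length[of n] by (simp add: power_add)
qed simp

lemma bit_length_numerals [simp]:
  "bit_length 0 = 1" "bit_length (Suc 0) = 1" "bit_length 2 = 2" "bit_length 4 = 3" "bit_length 8 = 4"
  using floor_log_power[of 1] floor_log_power[of 2] floor_log_power[of 3]
  by (simp_all add: bit_length_def)

lemma bit_length_of_bool [simp]: "bit_length (of_bool b) = 1"
  by (cases b) simp_all

section \<open>The program\<close>

text \<open>
  Functions take right-nested tuples: \<open>A0\<close>, \<open>A1\<close>, \<open>\<dots>\<close> are the components of the argument and \<open>R1\<close>, \<open>R2\<close>,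
  \<open>\<dots>\<close> what remains after dropping components. The numbers in calls are positions in \<open>matching_prog\<close>.
\<close>

abbreviation mk (infixr "\<diamondop>" 60) where "a \<diamondop> b \<equiv> Mk_Cell a b"
abbreviation cell (infixr "\<bullet>" 60) where "x \<bullet> y \<equiv> Cell x y"

abbreviation (input) "R1 \<equiv> Tail (Var 0)"
abbreviation (input) "R2 \<equiv> Tail R1"
abbreviation (input) "R3 \<equiv> Tail R2"
abbreviation (input) "R4 \<equiv> Tail R3"
abbreviation (input) "A0 \<equiv> Head (Var 0)"
abbreviation (input) "A1 \<equiv> Head R1"
abbreviation (input) "A2 \<equiv> Head R2"
abbreviation (input) "A3 \<equiv> Head R3"

text \<open>Below the \<open>Let_In\<close>, \<open>Var 0\<close> is the list of pairs and
  \<open>Var 1\<close> the input. Products of 0/1 tests act as conjunction, and \<open>k\<close> is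
  compared with the length plus 1 because only a strict order is available. The polynomial in
  \<open>k\<close> is the exponent of the modulus.\<close>

definition "main_body =
  Let_In (Call 13 A0)
    (If_Nonzero
      (Op Times (Op Equal (Call 14 (Head (Tail (Var 1)))) (Lit 0))
        (Op Times (Op Less (Lit 1) (Tail (Tail (Var 1))))
          (Op Less (Tail (Tail (Var 1))) (Op Plus (Call 15 (Var 0)) (Lit 1)))))
      (Call 16 (Tail (Tail (Var 1)) \<diamondop> Var 0) \<diamondop> Lit 0)
      (Call 21
        (Call 19 (Call 20 (Head (Var 1)) \<diamondop>
          Op Plus (Op Plus (Op Times (Op Times (Lit 8) (Tail (Tail (Var 1)))) (Tail (Tail (Var 1))))
            (Op Times (Lit 2) (Tail (Tail (Var 1))))) (Lit 1)) \<diamondop>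
         Tail (Tail (Var 1)) \<diamondop> Head (Tail (Var 1)) \<diamondop> Var 0)))"

text \<open>Leafwise linear combination of two trees modulo \<open>N\<close>. Coefficients 1, 1 give
  sums, coefficients 0, 0 the zero tree of the same shape.\<close>

definition "comb_body =
  If_Nonzero (Is_Cell A3)
    (Call 1 (A0 \<diamondop> A1 \<diamondop> A2 \<diamondop> Head A3 \<diamondop> Head R4) \<diamondop> Call 1 (A0 \<diamondop> A1 \<diamondop> A2 \<diamondop> Tail A3 \<diamondop> Tail R4))
    (Op Modulo (Op Plus (Op Times A1 A3) (Op Times A2 R4)) A0)"

text \<open>The minus sign in the second clause of \<open>wedge\<close> becomes multiplication by
  \<open>N - 1\<close>, as \<open>Minus\<close> truncates at 0.\<close>

definition "wedge_body =
  If_Nonzero (Is_Cell A1)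
    (Call 2 (A0 \<diamondop> Tail A1 \<diamondop> Head R2) \<diamondop>
     Call 1 (A0 \<diamondop> Head A1 \<diamondop> Op Minus A0 (Lit 1) \<diamondop> Head R2 \<diamondop> Call 2 (A0 \<diamondop> Tail A1 \<diamondop> Tail R2)))
    (Lit 0)"

text \<open>The half without the first basis vector is the smaller unit; the other half is the zero
  tree of the same shape.\<close>

definition "unit_body =
  If_Nonzero R1
    (Let_In (Call 3 (A0 \<diamondop> Op Minus R1 (Lit 1)))
      (Var 0 \<diamondop> Call 1 (Head (Var 1) \<diamondop> Lit 0 \<diamondop> Lit 0 \<diamondop> Var 0 \<diamondop> Var 0)))
    (Lit 1)"

definition "top_body = If_Nonzero (Is_Cell (Var 0)) (Call 4 (Tail (Var 0))) (Var 0)"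

text \<open>Prepends a geometric progression to a given list. Ratio 0 and start 0 yield the zero
  padding of the other copy.\<close>

definition "powers_body =
  If_Nonzero A2 (A1 \<diamondop> Call 5 (A0 \<diamondop> Op Times A1 A0 \<diamondop> Op Minus A2 (Lit 1) \<diamondop> R3)) R3"

definition "vertex_body =
  Call 2 (A0 \<diamondop> Call 5 (Lit 0 \<diamondop> Lit 0 \<diamondop> A1 \<diamondop> Call 5 (A2 \<diamondop> Lit 1 \<diamondop> A1 \<diamondop> Lit 0)) \<diamondop>
    Call 2 (A0 \<diamondop> Call 5 (A2 \<diamondop> Lit 1 \<diamondop> A1 \<diamondop> Call 5 (Lit 0 \<diamondop> Lit 0 \<diamondop> A1 \<diamondop> Lit 0)) \<diamondop> R3))"

definition "edges_body =
  If_Nonzero (Is_Cell A2)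
    (Call 1 (A0 \<diamondop> Lit 1 \<diamondop> Lit 1 \<diamondop>
      Call 6 (A0 \<diamondop> A1 \<diamondop> Head (Head A2) \<diamondop> Call 6 (A0 \<diamondop> A1 \<diamondop> Tail (Head A2) \<diamondop> R3)) \<diamondop>
      Call 7 (A0 \<diamondop> A1 \<diamondop> Tail A2 \<diamondop> R3)))
    (Call 1 (A0 \<diamondop> Lit 0 \<diamondop> Lit 0 \<diamondop> R3 \<diamondop> R3))"

definition "iterate_body =
  If_Nonzero A3
    (Call 8 (A0 \<diamondop> A1 \<diamondop> A2 \<diamondop> Op Minus A3 (Lit 1) \<diamondop> Call 7 (A0 \<diamondop> A1 \<diamondop> A2 \<diamondop> R4)))
    (Call 4 R4)"

definition "member_body =
  If_Nonzero (Is_Cell R1)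
    (If_Nonzero
      (Op Plus
        (Op Times (Op Equal (Head A0) (Head A1)) (Op Equal (Tail A0) (Tail A1)))
        (Op Times (Op Equal (Head A0) (Tail A1)) (Op Equal (Tail A0) (Head A1))))
      (Lit 1) (Call 9 (A0 \<diamondop> R2)))
    (Lit 0)"

definition "common_body =
  If_Nonzero (Is_Cell A0)
    (Let_In (Call 10 (Tail A0 \<diamondop> R1))
      (If_Nonzero (Call 9 (Head (Head (Var 1)) \<diamondop> Tail (Var 1))) (Head (Head (Var 1)) \<diamondop> Var 0) (Var 0)))
    (Lit 0)"

definition "score_body =
  If_Nonzero (Is_Cell R3)
    (If_Nonzero (Tail A3)
      (Call 11 (A0 \<diamondop> A1 \<diamondop> Call 10 (A2 \<diamondop> Head A3) \<diamondop> R4))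
      (Op Modulo
        (Op Plus (Call 11 (A0 \<diamondop> A1 \<diamondop> A2 \<diamondop> R4))
          (Op Times (Op Minus A0 (Lit 1)) (Call 11 (A0 \<diamondop> A1 \<diamondop> Call 10 (A2 \<diamondop> Head A3) \<diamondop> R4))))
        A0))
    (Call 8 (A0 \<diamondop> Op Times (Lit 2) A1 \<diamondop> A2 \<diamondop> A1 \<diamondop> Call 3 (A0 \<diamondop> Op Times (Lit 4) A1)))"

definition "star_body =
  If_Nonzero (Is_Cell A1) ((A0 \<diamondop> Head A1) \<diamondop> Call 12 (A0 \<diamondop> Tail A1 \<diamondop> R2)) R2"

definition "pairs_body =
  If_Nonzero (Is_Cell (Var 0)) (Call 12 (Head (Var 0) \<diamondop> Tail (Var 0) \<diamondop> Call 13 (Tail (Var 0)))) (Lit 0)"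

definition "positive_body =
  If_Nonzero (Is_Cell (Var 0)) (If_Nonzero (Tail A0) (Lit 1) (Call 14 (Tail (Var 0)))) (Lit 0)"

definition "length_body =
  If_Nonzero (Is_Cell (Var 0)) (Op Plus (Call 15 (Tail (Var 0))) (Lit 1)) (Lit 0)"

definition "take_body =
  If_Nonzero A0 (A1 \<diamondop> Call 16 (Op Minus A0 (Lit 1) \<diamondop> R2)) (Lit 0)"

definition "append_body =
  If_Nonzero (Is_Cell A0) (Head A0 \<diamondop> Call 17 (Tail A0 \<diamondop> R1)) R1"

definition "prune_body =
  If_Nonzero (Is_Cell R4)
    (If_Nonzero (Call 11 (A0 \<diamondop> A1 \<diamondop> Call 17 (A3 \<diamondop> Tail R4) \<diamondop> A2))
      (Call 18 (A0 \<diamondop> A1 \<diamondop> A2 \<diamondop> A3 \<diamondop> Tail R4))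
      (Call 18 (A0 \<diamondop> A1 \<diamondop> A2 \<diamondop> (Head R4 \<diamondop> A3) \<diamondop> Tail R4)))
    A3"

definition "power_body =
  If_Nonzero R1 (Op Times A0 (Call 19 (A0 \<diamondop> Op Minus R1 (Lit 1)))) (Lit 1)"

definition "label_body =
  If_Nonzero (Is_Cell (Var 0)) (Op Plus (Op Plus A0 (Lit 1)) (Call 20 (Tail (Var 0)))) (Lit 2)"

definition "search_body =
  If_Nonzero (Call 11 (A0 \<diamondop> A1 \<diamondop> R3 \<diamondop> A2))
    (Call 18 (A0 \<diamondop> A1 \<diamondop> A2 \<diamondop> Lit 0 \<diamondop> R3) \<diamondop> Lit 0)
    (Lit 0)"

definition matching_prog :: prog where
  "matching_prog =
    [main_body, comb_body, wedge_body, unit_body, top_body, powers_body, vertex_body, edges_body,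
     iterate_body, member_body, common_body, score_body, star_body, pairs_body, positive_body,
     length_body, take_body, append_body, prune_body, power_body, label_body, search_body]"

text \<open>Time is bounded from above instead of given exactly, so that estimates for called
  functions can be plugged in.\<close>

definition ev :: "val list \<Rightarrow> expr \<Rightarrow> val \<Rightarrow> nat \<Rightarrow> bool" where
  "ev env e v C \<longleftrightarrow> (\<exists>c\<le>C. eval matching_prog env e v c)"

definition fn :: "nat \<Rightarrow> val \<Rightarrow> val \<Rightarrow> nat \<Rightarrow> bool" where
  "fn g x y C \<longleftrightarrow> g < length matching_prog \<and> ev [x] (matching_prog ! g) y C"

lemma ev_Var: "ev (v # env) (Var 0) v 1" "ev (w # v # env) (Var 1) v 1"
  using eval_Var[of 0 "v # env"] eval_Var[of 1 "w # v # env"] by (auto simp: ev_def)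

lemma ev_Lit: "ev env (Lit n) (Atom n) 1"
  unfolding ev_def using eval_Lit[of matching_prog env n] by blast

lemma ev_Op: "ev env a (Atom m) c1 \<Longrightarrow> ev env b (Atom n) c2 \<Longrightarrow>
    ev env (Op f a b) (Atom (binop_val f m n)) (1 + c1 + c2 + bit_length m + bit_length n)"
  unfolding ev_def
  by (elim exE conjE, rule exI, rule conjI[rotated], rule eval_Op, (assumption)+, simp)

lemma ev_Mk_Cell: "ev env a v c1 \<Longrightarrow> ev env b w c2 \<Longrightarrow> ev env (a \<diamondop> b) (v \<bullet> w) (1 + c1 + c2)"
  unfolding ev_def
  by (elim exE conjE, rule exI, rule conjI[rotated], rule eval_Mk_Cell, (assumption)+, simp)

lemma ev_Head: "ev env a (v \<bullet> w) c \<Longrightarrow> ev env (Head a) v (1 + c)"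
  unfolding ev_def
  by (elim exE conjE, rule exI, rule conjI[rotated], rule eval_Head, (assumption)+, simp)

lemma ev_Tail: "ev env a (v \<bullet> w) c \<Longrightarrow> ev env (Tail a) w (1 + c)"
  unfolding ev_def
  by (elim exE conjE, rule exI, rule conjI[rotated], rule eval_Tail, (assumption)+, simp)

lemma ev_Is_Cell: "ev env a v c \<Longrightarrow> ev env (Is_Cell a) (Atom (of_bool (\<exists>x y. v = x \<bullet> y))) (1 + c)"
  unfolding ev_def
  by (elim exE conjE, rule exI, rule conjI[rotated], rule eval_Is_Cell, (assumption)+, simp)

lemma ev_If_True: "ev env a v c1 \<Longrightarrow> ev env b w c2 \<Longrightarrow> v \<noteq> Atom 0 \<Longrightarrow>
    ev env (If_Nonzero a b d) w (1 + c1 + c2)"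
  unfolding ev_def
  by (elim exE conjE, rule exI, rule conjI[rotated], rule eval_If_True, (assumption)+, simp)

lemma ev_If_False: "ev env a v c1 \<Longrightarrow> ev env d w c2 \<Longrightarrow> v = Atom 0 \<Longrightarrow>
    ev env (If_Nonzero a b d) w (1 + c1 + c2)"
  unfolding ev_def
  by (elim exE conjE, hypsubst, rule exI, rule conjI[rotated], rule eval_If_False, (assumption)+, simp)

lemma ev_Let_In: "ev env a v c1 \<Longrightarrow> ev (v # env) b w c2 \<Longrightarrow> ev env (Let_In a b) w (1 + c1 + c2)"
  unfolding ev_def
  by (elim exE conjE, rule exI, rule conjI[rotated], rule eval_Let_In, (assumption)+, simp)

lemma ev_Call: "ev env a v c1 \<Longrightarrow> fn g v w c2 \<Longrightarrow> ev env (Call g a) w (1 + c1 + c2)"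
  unfolding fn_def ev_def
  by (elim exE conjE, rule exI, rule conjI[rotated], rule eval_Call, (assumption)+, simp)

lemmas ev_rules = ev_Var ev_Lit ev_Op ev_Mk_Cell ev_Head ev_Tail ev_Is_Cell ev_Let_In ev_Call

text \<open>The evaluation rules first instantiate the result \<open>y'\<close> and the cost
  \<open>c\<close> by following the body; the comparison with the intended \<open>y\<close> and
  \<open>C\<close> is left as pure equations and arithmetic.\<close>

lemma fnI: "matching_prog ! g = e \<Longrightarrow> ev [x] e y' c \<Longrightarrow> y' = y \<Longrightarrow> c \<le> C \<Longrightarrow>
    g < length matching_prog \<Longrightarrow> fn g x y C"
  unfolding fn_def ev_def using order_trans by blast

lemma length_prog [simp]: "length matching_prog = 22"
  by (simp add: matching_prog_def)

lemma prog_nth: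
  "matching_prog ! 0 = main_body" "matching_prog ! 1 = comb_body" "matching_prog ! 2 = wedge_body"
  "matching_prog ! 3 = unit_body" "matching_prog ! 4 = top_body" "matching_prog ! 5 = powers_body"
  "matching_prog ! 6 = vertex_body" "matching_prog ! 7 = edges_body" "matching_prog ! 8 = iterate_body"
  "matching_prog ! 9 = member_body" "matching_prog ! 10 = common_body" "matching_prog ! 11 = score_body"
  "matching_prog ! 12 = star_body" "matching_prog ! 13 = pairs_body" "matching_prog ! 14 = positive_body"
  "matching_prog ! 15 = length_body" "matching_prog ! 16 = take_body" "matching_prog ! 17 = append_body"
  "matching_prog ! 18 = prune_body" "matching_prog ! 19 = power_body" "matching_prog ! 20 = label_body"
  "matching_prog ! 21 = search_body"
  by (simp_all add: matching_prog_def)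

lemmas fn_intro = prog_nth[THEN fnI]
lemmas main_fnI = fn_intro(1)[unfolded main_body_def]
lemmas comb_fnI = fn_intro(2)[unfolded comb_body_def]
lemmas wedge_fnI = fn_intro(3)[unfolded wedge_body_def]
lemmas unit_fnI = fn_intro(4)[unfolded unit_body_def]
lemmas top_fnI = fn_intro(5)[unfolded top_body_def]
lemmas powers_fnI = fn_intro(6)[unfolded powers_body_def]
lemmas vertex_fnI = fn_intro(7)[unfolded vertex_body_def]
lemmas edges_fnI = fn_intro(8)[unfolded edges_body_def]
lemmas iterate_fnI = fn_intro(9)[unfolded iterate_body_def]
lemmas member_fnI = fn_intro(10)[unfolded member_body_def]
lemmas common_fnI = fn_intro(11)[unfolded common_body_def]
lemmas score_fnI = fn_intro(12)[unfolded score_body_def]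
lemmas star_fnI = fn_intro(13)[unfolded star_body_def]
lemmas pairs_fnI = fn_intro(14)[unfolded pairs_body_def]
lemmas positive_fnI = fn_intro(15)[unfolded positive_body_def]
lemmas length_fnI = fn_intro(16)[unfolded length_body_def]
lemmas take_fnI = fn_intro(17)[unfolded take_body_def]
lemmas append_fnI = fn_intro(18)[unfolded append_body_def]
lemmas prune_fnI = fn_intro(19)[unfolded prune_body_def]
lemmas power_fnI = fn_intro(20)[unfolded power_body_def]
lemmas label_fnI = fn_intro(21)[unfolded label_body_def]
lemmas search_fnI = fn_intro(22)[unfolded search_body_def]

text \<open>Elements of the exterior algebra are stored as full binary trees with residues modulo \<open>N\<close> as
  leaves.\<close>

primrec enc :: "nat \<Rightarrow> nat \<Rightarrow> (bool list \<Rightarrow> int) \<Rightarrow> val" where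
  "enc N 0 f = Atom (nat (f [] mod int N))"
| "enc N (Suc n) f = enc N n (\<lambda>b. f (False # b)) \<bullet> enc N n (\<lambda>b. f (True # b))"

lemma enc_cong: "(\<And>b. length b = n \<Longrightarrow> f b mod int N = g b mod int N) \<Longrightarrow> enc N n f = enc N n g"
proof (induction n arbitrary: f g)
  case (Suc n)
  show ?case
    using Suc.IH[of "\<lambda>b. f (False # b)" "\<lambda>b. g (False # b)"]
      Suc.IH[of "\<lambda>b. f (True # b)" "\<lambda>b. g (True # b)"] Suc.prems by simp
qed simp

lemma bit_length_residue: "0 < N \<Longrightarrow> bit_length (nat (x mod int N)) \<le> bit_length N"
  by (rule bit_length_mono) (simp add: nat_le_iff less_imp_le)

lemma comb_leaf:
  assumes "0 < N"
  shows "(c * nat (x mod int N) + d * nat (y mod int N)) mod N = nat ((int c * x + int d * y) mod int N)"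
    (is "?l = ?r")
proof -
  have "int ?l = int ?r"
    using assms mod_add_cong[OF mod_mult_right_eq[of "int c" x "int N"] mod_mult_right_eq[of "int d" y "int N"]]
    by (simp add: zmod_int)
  then show ?thesis by linarith
qed

text \<open>Naming the excess of \<open>Z * 4 ^ n\<close> over \<open>Z\<close> turns the cost
  estimates into linear arithmetic.\<close>

lemma scaled_power_split:
  fixes Z :: nat
  assumes "1 \<le> Z"
  obtains X where "Z * 4 ^ n = Z + X"
  using le_Suc_ex[of Z "Z * 4 ^ n"] by auto

text \<open>The trees have just \<open>2 ^ n\<close> leaves. With base 4 the two recursive calls use
  only half of the budget at depth \<open>n + 1\<close>, and the other half absorbs the overhead.
  The later tree functions exploit the same slack.\<close>

lemma comb_fn:
  assumes N: "0 < N" "bit_length N \<le> Z" and c: "bit_length c \<le> Z" "bit_length d \<le> Z"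
  shows "fn 1 (Atom N \<bullet> Atom c \<bullet> Atom d \<bullet> enc N n f \<bullet> enc N n g)
    (enc N n (\<lambda>b. int c * f b + int d * g b)) (100 * (Z * 4 ^ n))"
proof (induction n arbitrary: f g)
  case 0
  let ?x = "nat (f [] mod int N)" and ?y = "nat (g [] mod int N)"
  have "bit_length ?x \<le> Z" "bit_length ?y \<le> Z"
    using bit_length_residue[OF N(1)] N(2) order_trans by blast+
  moreover have "1 \<le> Z" using bit_length_pos(2)[of N] N(2) by linarith
  ultimately show ?case unfolding enc.simps
    using c N(2) bit_length_mult[of c ?x] bit_length_mult[of d ?y]
      bit_length_add[of "c * ?x" "d * ?y"]
    by - (rule comb_fnI, (rule ev_rules ev_If_False)+, simp_all add: comb_leaf[OF N(1)])
next
  case (Suc n)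
  have Z: "1 \<le> Z" using bit_length_pos(2)[of N] N(2) by linarith
  then obtain X where X: "Z * 4 ^ n = Z + X" by (rule scaled_power_split)
  with Z show ?case unfolding enc.simps
    by - (rule comb_fnI, (rule ev_rules ev_If_True Suc.IH)+, simp_all)
qed

primrec vlist :: "val list \<Rightarrow> val \<Rightarrow> val" where
  "vlist [] z = z"
| "vlist (x # xs) z = x \<bullet> vlist xs z"

lemma vlist_append: "vlist (xs @ ys) z = vlist xs (vlist ys z)"
  by (induction xs) simp_all

text \<open>Justifies \<open>N - 1\<close> as a substitute for -1, both in the wedge product and in
  inclusion-exclusion.\<close>

lemma minus_one_mod: "0 < N \<Longrightarrow> (x + int (N - 1) * y) mod int N = (x - y) mod int N"
proof -
  assume "0 < N"
  then have "x + int (N - 1) * y = (x - y) + y * int N" by (simp add: algebra_simps of_nat_diff)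
  then show ?thesis by (simp only: mod_mult_self1)
qed

lemma wedge_fn:
  assumes N: "0 < N" "bit_length N \<le> Z" and u: "\<forall>c\<in>set u. bit_length c \<le> Z"
  shows "fn 2 (Atom N \<bullet> vlist (map Atom u) (Atom 0) \<bullet> enc N (length u) f)
    (enc N (length u) (wedge (map int u) f)) (200 * (Z * 4 ^ length u))"
  using u
proof (induction u arbitrary: f)
  case Nil
  have "1 \<le> Z" using bit_length_pos(2)[of N] N(2) by linarith
  then show ?case
    unfolding vlist.simps list.map
    by - (rule wedge_fnI, (rule ev_rules ev_If_False)+, simp_all)
next
  case (Cons c u)
  have Z: "1 \<le> Z" using bit_length_pos(2)[of N] N(2) by linarith
  then obtain X where X: "Z * 4 ^ length u = Z + X" by (rule scaled_power_split)
  have c: "bit_length c \<le> Z" and d: "bit_length (binop_val Minus N 1) \<le> Z"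
    using Cons.prems bit_length_mono[of "N - 1" N] N(2) by auto
  have eq: "enc N (length u) (\<lambda>b. int c * g b + int (N - Suc 0) * h b)
      = enc N (length u) (\<lambda>b. int c * g b - h b)" for g h
    by (rule enc_cong) (use minus_one_mod[OF N(1)] in simp)
  have IH: "fn 2 (Atom N \<bullet> vlist (map Atom u) (Atom 0) \<bullet> enc N (length u) f)
    (enc N (length u) (wedge (map int u) f)) (200 * (Z * 4 ^ length u))" for f
    using Cons by simp
  show ?case
    unfolding vlist.simps list.map list.size add_0_right add_Suc_right enc.simps
    using X N(2) Z
    by - (rule wedge_fnI, (rule ev_rules ev_If_True IH comb_fn[OF N c d])+, simp_all add: eq)
qed

lemma unit_fn:
  assumes N: "2 \<le> N" "bit_length N \<le> Z" and n: "bit_length n \<le> Z"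
  shows "fn 3 (Atom N \<bullet> Atom n) (enc N n unit_ext) (200 * (Z * 4 ^ n))"
  using n
proof (induction n)
  case 0
  then show ?case using N
    by - (rule unit_fnI, (rule ev_rules ev_If_False)+, simp_all add: unit_ext_def)
next
  case (Suc n)
  have "bit_length n \<le> bit_length (Suc n)" by (rule bit_length_mono) simp
  with Suc have IH: "fn 3 (Atom N \<bullet> Atom (binop_val Minus (Suc n) 1)) (enc N n unit_ext) (200 * (Z * 4 ^ n))"
    by simp
  have Z: "1 \<le> Z" using bit_length_pos(2)[of N] N(2) by linarith
  then obtain X where X: "Z * 4 ^ n = Z + X" by (rule scaled_power_split)
  have N0: "0 < N" using N(1) by simp
  have b0: "bit_length 0 \<le> Z" using Z by simp
  have "unit_ext (False # b) = unit_ext b" "unit_ext (True # b) = 0" for b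
    by (simp_all add: unit_ext_def)
  then have eq: "(\<lambda>b. unit_ext (False # b)) = unit_ext" "(\<lambda>b. unit_ext (True # b)) = (\<lambda>b. 0)"
    by auto
  show ?case
    unfolding enc.simps eq
    using X Suc.prems Z
    by - (rule unit_fnI, (rule ev_rules ev_If_True IH comb_fn[OF N0 N(2) b0 b0])+, simp_all)
qed

lemma top_fn: "fn 4 (enc N n f) (Atom (nat (f (replicate n True) mod int N))) (20 * Suc n)"
proof (induction n arbitrary: f)
  case 0
  show ?case unfolding enc.simps
    by (rule top_fnI, (rule ev_rules ev_If_False)+, simp_all)
next
  case (Suc n)
  show ?case unfolding enc.simps
    by (rule top_fnI, (rule ev_rules ev_If_True Suc.IH)+, simp_all)
qed

lemma map_upt_Suc': "map g [0..<Suc j] = g 0 # map (\<lambda>i. g (Suc i)) [0..<j]"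
  by (simp add: upt_conv_Cons map_Suc_upt[symmetric] comp_def del: upt_Suc)

lemma powers_fn:
  assumes "bit_length v \<le> Z" "bit_length j \<le> Z" "\<And>i. i \<le> j \<Longrightarrow> bit_length (c * v ^ i) \<le> Z"
  shows "fn 5 (Atom v \<bullet> Atom c \<bullet> Atom j \<bullet> z) (vlist (map (\<lambda>i. Atom (c * v ^ i)) [0..<j]) z)
    (100 * (Z * Suc j))"
  using assms(2,3)
proof (induction j arbitrary: c)
  case 0
  have "1 \<le> Z" using bit_length_pos(2)[of v] assms(1) by linarith
  then show ?case
    by - (rule powers_fnI, (rule ev_rules ev_If_False)+, simp_all)
next
  case (Suc j)
  have Z: "1 \<le> Z" using bit_length_pos(2)[of v] assms(1) by linarith
  have c: "bit_length c \<le> Z" using Suc.prems(2)[of 0] by simp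
  have j: "bit_length j \<le> Z"
    using bit_length_mono[of j "Suc j"] Suc.prems(1) by simp
  have "bit_length (c * v * v ^ i) \<le> Z" if "i \<le> j" for i
    using Suc.prems(2)[of "Suc i"] that by (simp add: mult.assoc)
  from Suc.IH[OF j this] have IH:
    "fn 5 (Atom v \<bullet> Atom (binop_val Times c v) \<bullet> Atom (binop_val Minus (Suc j) 1) \<bullet> z)
      (vlist (map (\<lambda>i. Atom (c * v * v ^ i)) [0..<j]) z) (100 * (Z * Suc j))"
    by simp
  show ?case
    unfolding map_upt_Suc'
    using c Z assms(1) Suc.prems(1)
    by - (rule powers_fnI, (rule ev_rules ev_If_True IH)+, simp_all add: mult.assoc)
qed

definition small :: "nat \<Rightarrow> nat \<Rightarrow> nat \<Rightarrow> bool" where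
  "small Z M v \<longleftrightarrow> bit_length v \<le> Z \<and> (\<forall>i\<le>M. bit_length (v ^ i) \<le> Z)"

lemma Suc_le_4_power: "Suc M \<le> 4 ^ (2 * M)"
proof -
  have "Suc M \<le> 2 ^ M" using less_exp[of M] by (simp add: Suc_le_eq)
  also have "(2 :: nat) ^ M \<le> 4 ^ (2 * M)"
    by (rule order_trans[OF power_mono[of 2 4 M]]) (simp_all add: power_increasing)
  finally show ?thesis .
qed

lemma vertex_fn:
  assumes N: "0 < N" "bit_length N \<le> Z" and M: "bit_length M \<le> Z" and v: "small Z M v"
  shows "fn 6 (Atom N \<bullet> Atom M \<bullet> Atom v \<bullet> enc N (2 * M) f)
    (enc N (2 * M) (vertex_step M (int v) f)) (1000 * (Z * 4 ^ (2 * M)))"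
proof -
  let ?p = "map Atom (map (\<lambda>i. v ^ i) [0..<M])" and ?z = "map Atom (replicate M 0)"
  have Z: "1 \<le> Z" using bit_length_pos(2)[of N] N(2) by linarith
  have "Z * Suc M \<le> Z * 4 ^ (2 * M)"
    using Suc_le_4_power[of M] by (rule mult_le_mono2)
  then obtain X where X: "Z * 4 ^ (2 * M) = Z * Suc M + X" using le_Suc_ex by blast
  have p: "fn 5 (Atom v \<bullet> Atom 1 \<bullet> Atom M \<bullet> z) (vlist ?p z) (100 * (Z * Suc M))" for z
    using powers_fn[of v Z M 1 z] M v by (simp add: small_def comp_def)
  have z: "fn 5 (Atom 0 \<bullet> Atom 0 \<bullet> Atom M \<bullet> z) (vlist ?z z) (100 * (Z * Suc M))" for z
    using powers_fn[of 0 Z M 0 z] M Z by (simp add: map_replicate_trivial map_replicate_const)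
  have bits: "\<forall>c\<in>set (map (\<lambda>i. v ^ i) [0..<M]). bit_length c \<le> Z"
    "\<forall>c\<in>set (replicate M 0). bit_length c \<le> Z"
    using v Z by (auto simp: small_def)
  have w1: "fn 2 (Atom N \<bullet> vlist ?p (vlist ?z (Atom 0)) \<bullet> enc N (2 * M) f)
    (enc N (2 * M) (wedge (powers M (int v) @ replicate M 0) f)) (200 * (Z * 4 ^ (2 * M)))" for f
    using wedge_fn[OF N, of "map (\<lambda>i. v ^ i) [0..<M] @ replicate M 0" f] bits
    by (simp add: ball_Un vlist_append powers_def comp_def mult_2 del: set_replicate)
  have w2: "fn 2 (Atom N \<bullet> vlist ?z (vlist ?p (Atom 0)) \<bullet> enc N (2 * M) f)
    (enc N (2 * M) (wedge (replicate M 0 @ powers M (int v)) f)) (200 * (Z * 4 ^ (2 * M)))" for f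
    using wedge_fn[OF N, of "replicate M 0 @ map (\<lambda>i. v ^ i) [0..<M]" f] bits
    by (simp add: ball_Un vlist_append powers_def comp_def mult_2 del: set_replicate)
  show ?thesis
    unfolding vertex_step_def
    by (rule vertex_fnI, (rule ev_rules p z w1 w2)+) (use X Z in simp_all)
qed

definition edge_val :: "edge \<Rightarrow> val" where
  "edge_val e = Atom (fst e) \<bullet> Atom (snd e)"

lemma edge_val_Pair: "edge_val (a, b) = Atom a \<bullet> Atom b"
  by (simp add: edge_val_def)

abbreviation edges_val :: "edge list \<Rightarrow> val" where
  "edges_val E \<equiv> vlist (map edge_val E) (Atom 0)"

lemma edges_fn:
  assumes N: "0 < N" "bit_length N \<le> Z" and M: "bit_length M \<le> Z"
    and E: "\<forall>e\<in>set E. small Z M (fst e) \<and> small Z M (snd e)"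
  shows "fn 7 (Atom N \<bullet> Atom M \<bullet> edges_val E \<bullet> enc N (2 * M) f)
    (enc N (2 * M) (edges_step M E f)) (3000 * (Suc (length E) * (Z * 4 ^ (2 * M))))"
  using E
proof (induction E)
  case Nil
  have Z: "1 \<le> Z" using bit_length_pos(2)[of N] N(2) by linarith
  then obtain X where X: "Z * 4 ^ (2 * M) = Z + X" by (rule scaled_power_split)
  have b0: "bit_length 0 \<le> Z" using Z by simp
  show ?case
    unfolding vlist.simps list.map
    using X Z by - (rule edges_fnI, (rule ev_rules ev_If_False comb_fn[OF N b0 b0])+, simp_all add: edges_step_def)
next
  case (Cons e E)
  have Z: "1 \<le> Z" using bit_length_pos(2)[of N] N(2) by linarith
  then obtain X where X: "Z * 4 ^ (2 * M) = Z + X" by (rule scaled_power_split)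
  have b1: "bit_length 1 \<le> Z" using Z by simp
  obtain a b where e: "e = (a, b)" by (cases e)
  have v: "small Z M a" "small Z M b" using Cons.prems by (simp_all add: e)
  have IH: "fn 7 (Atom N \<bullet> Atom M \<bullet> edges_val E \<bullet> enc N (2 * M) f)
    (enc N (2 * M) (edges_step M E f)) (3000 * (Suc (length E) * (Z * 4 ^ (2 * M))))"
    using Cons by simp
  have eq: "edges_step M (e # E) f = (\<lambda>b. int 1 * edge_step M e f b + int 1 * edges_step M E f b)"
    by (simp add: edges_step_def fun_eq_iff)
  show ?case
    unfolding vlist.simps list.map eq edge_step_def unfolding e edge_val_Pair fst_conv snd_conv
    using X Z by - (rule edges_fnI, (rule ev_rules ev_If_True IH vertex_fn[OF N M v(1)] vertex_fn[OF N M v(2)]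
      comb_fn[OF N b1 b1])+, simp_all)
qed

lemma iterate_fn:
  assumes N: "0 < N" "bit_length N \<le> Z" and M: "bit_length M \<le> Z" and j: "bit_length j \<le> Z"
    and E: "\<forall>e\<in>set E. small Z M (fst e) \<and> small Z M (snd e)"
  shows "fn 8 (Atom N \<bullet> Atom M \<bullet> edges_val E \<bullet> Atom j \<bullet> enc N (2 * M) f)
    (Atom (nat ((edges_step M E ^^ j) f (replicate (2 * M) True) mod int N)))
    (5000 * (Suc j * (Suc (length E) * (Z * 4 ^ (2 * M)))))"
  using j
proof (induction j arbitrary: f)
  case 0
  have Z: "1 \<le> Z" using bit_length_pos(2)[of N] N(2) by linarith
  have "Suc M * 1 \<le> 4 ^ (2 * M) * Z"
    using Suc_le_4_power[of M] Z by (intro mult_le_mono) simp_all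
  then obtain X where X: "Z * 4 ^ (2 * M) = Suc M + X"
    using le_Suc_ex[of "Suc M" "Z * 4 ^ (2 * M)"] by (auto simp: mult.commute)
  show ?case
    using X by - (rule iterate_fnI, (rule ev_rules ev_If_False top_fn)+, simp_all)
next
  case (Suc j)
  have Z: "1 \<le> Z" using bit_length_pos(2)[of N] N(2) by linarith
  then obtain X where X: "Z * 4 ^ (2 * M) = Z + X" by (rule scaled_power_split)
  define Y where "Y = Suc (length E) * (Z * 4 ^ (2 * M))"
  have Y: "1 \<le> Y" "Z \<le> Y" using X Z unfolding Y_def by simp_all
  have "bit_length j \<le> Z"
    using bit_length_mono[of j "Suc j"] Suc.prems by simp
  from Suc.IH[OF this] have IH: "fn 8 (Atom N \<bullet> Atom M \<bullet> edges_val E \<bullet> Atom (binop_val Minus (Suc j) 1) \<bullet> enc N (2 * M) f)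
    (Atom (nat ((edges_step M E ^^ j) f (replicate (2 * M) True) mod int N)))
    (5000 * (Suc j * Y))" for f
    by (simp add: Y_def)
  show ?case
    unfolding Y_def[symmetric]
    using Y Suc.prems by - (rule iterate_fnI, (rule ev_rules ev_If_True IH edges_fn[OF N M E, folded Y_def])+,
      simp_all add: funpow_swap1)
qed

lemma fn_mono: "fn g x y C \<Longrightarrow> C \<le> C' \<Longrightarrow> fn g x y C'"
  unfolding fn_def ev_def by (meson order_trans)

lemma member_fn:
  assumes "bit_length (fst e) \<le> Z" "bit_length (snd e) \<le> Z"
    and "\<forall>f\<in>set P. bit_length (fst f) \<le> Z \<and> bit_length (snd f) \<le> Z"
  shows "fn 9 (edge_val e \<bullet> edges_val P) (Atom (of_bool (ends e \<in> ends ` set P)))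
    (100 * (Z * Suc (length P)))"
  using assms(3)
proof (induction P)
  case Nil
  have "1 \<le> Z" using bit_length_pos(2)[of "fst e"] assms(1) by linarith
  then show ?case
    unfolding vlist.simps list.map
    by - (rule member_fnI, (rule ev_rules ev_If_False)+, simp_all)
next
  case (Cons f P)
  obtain a b where e: "e = (a, b)" by (cases e)
  obtain x y where f: "f = (x, y)" by (cases f)
  have Z: "1 \<le> Z" using bit_length_pos(2)[of "fst e"] assms(1) by linarith
  have bits: "bit_length a \<le> Z" "bit_length b \<le> Z" "bit_length x \<le> Z" "bit_length y \<le> Z"
    using assms(1,2) Cons.prems by (simp_all add: e f)
  have IH: "fn 9 ((Atom a \<bullet> Atom b) \<bullet> edges_val P) (Atom (of_bool (ends e \<in> ends ` set P)))
    (100 * (Z * Suc (length P)))"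
    using Cons by (simp add: e edge_val_Pair)
  have eq: "ends e = ends f \<longleftrightarrow> (a = x \<and> b = y) \<or> (a = y \<and> b = x)"
    by (simp add: e f ends_def doubleton_eq_iff)
  have b1: "bit_length (of_bool p * of_bool q) = 1" for p q by (cases p; cases q) simp_all
  show ?case
  proof (cases "ends e = ends f")
    case True
    then have nz: "Atom (binop_val Plus (binop_val Times (binop_val Equal a x) (binop_val Equal b y))
      (binop_val Times (binop_val Equal a y) (binop_val Equal b x))) \<noteq> Atom 0"
      using eq by auto
    show ?thesis
      unfolding vlist.simps list.map e f edge_val_Pair
      by (rule member_fnI, (rule ev_rules ev_If_True)+)
        (use Z bits nz True in \<open>simp_all add: b1 e f\<close>)
  next
    case False
    then have z: "Atom (binop_val Plus (binop_val Times (binop_val Equal a x) (binop_val Equal b y))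
      (binop_val Times (binop_val Equal a y) (binop_val Equal b x))) = Atom 0"
      using eq by auto
    show ?thesis
      unfolding vlist.simps list.map e f edge_val_Pair
      by (rule member_fnI, rule ev_If_True, (rule ev_rules)+, rule ev_If_False, (rule ev_rules IH[unfolded e])+)
        (use Z bits z False in \<open>simp_all add: b1 e f\<close>)
  qed
qed

lemma common_fn:
  assumes "\<forall>f\<in>set E \<union> set P. bit_length (fst f) \<le> Z \<and> bit_length (snd f) \<le> Z"
  shows "fn 10 (edges_val E \<bullet> edges_val P) (edges_val (common_edges E P))
    (200 * (Suc (length E) * (Suc Z * Suc (length P))))"
  using assms
proof (induction E)
  case Nil
  show ?case
    unfolding vlist.simps list.map
    by (rule common_fnI, (rule ev_rules ev_If_False)+) (simp_all add: common_edges_def)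
next
  case (Cons e E)
  define Y where "Y = Suc Z * Suc (length P)"
  have Y: "1 \<le> Y" by (simp add: Y_def)
  have IH: "fn 10 (edges_val E \<bullet> edges_val P) (edges_val (common_edges E P)) (200 * (Suc (length E) * Y))"
    using Cons by (simp add: Y_def)
  have "fn 9 (edge_val e \<bullet> edges_val P) (Atom (of_bool (ends e \<in> ends ` set P))) (100 * (Z * Suc (length P)))"
    by (rule member_fn) (use Cons.prems in auto)
  then have mem: "fn 9 (edge_val e \<bullet> edges_val P) (Atom (of_bool (ends e \<in> ends ` set P))) (100 * Y)"
    by (rule fn_mono) (simp add: Y_def)
  show ?case
  proof (cases "ends e \<in> ends ` set P")
    case True
    show ?thesis
      unfolding vlist.simps list.map Y_def[symmetric]
      by (rule common_fnI, (rule ev_rules ev_If_True IH mem)+)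
        (use True Y in \<open>simp_all add: common_edges_def\<close>)
  next
    case False
    show ?thesis
      unfolding vlist.simps list.map Y_def[symmetric]
      by (rule common_fnI, rule ev_If_True, (rule ev_rules IH mem)+, rule ev_If_False, (rule ev_rules IH mem)+)
        (use False Y in \<open>simp_all add: common_edges_def\<close>)
  qed
qed

definition sample_val :: "edge list \<times> bool \<Rightarrow> val" where
  "sample_val s = edges_val (fst s) \<bullet> Atom (of_bool (snd s))"

lemma sample_val_Pair: "sample_val (P, l) = edges_val P \<bullet> Atom (of_bool l)"
  by (simp add: sample_val_def)

abbreviation samples_val :: "(edge list \<times> bool) list \<Rightarrow> val" where
  "samples_val S \<equiv> vlist (map sample_val S) (Atom 0)"

definition negatives :: "(edge list \<times> bool) list \<Rightarrow> nat" where
  "negatives S = length (filter (\<lambda>s. \<not> snd s) S)"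

text \<open>\<open>D\<close> pays for one node of the recursion: the algebra at a leaf, or a
  filtering and some word arithmetic at an inner node. At most
  \<open>Suc (length S) * 2 ^ negatives S\<close> nodes occur. \<open>L\<close> stays fixed while
  filtering shrinks \<open>E\<close>.\<close>

lemma score_fn:
  assumes N: "2 \<le> N" "bit_length N \<le> Z" and k: "bit_length (4 * k) \<le> Z"
    and E: "\<forall>e\<in>set E. small Z (2 * k) (fst e) \<and> small Z (2 * k) (snd e)" "length E \<le> L"
    and S: "\<forall>s\<in>set S. length (fst s) \<le> Q \<and>
      (\<forall>f\<in>set (fst s). bit_length (fst f) \<le> Z \<and> bit_length (snd f) \<le> Z)"
    and D: "10000 * (Suc k * (Suc L * (Z * 4 ^ (4 * k)))) + 200 * (Suc L * (Suc Z * Suc Q)) + 100 * Z \<le> D"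
  shows "fn 11 (Atom N \<bullet> Atom k \<bullet> edges_val E \<bullet> samples_val S) (Atom (nat (score k E S mod int N)))
    (D * (Suc (length S) * 2 ^ negatives S))"
  using E S
proof (induction S arbitrary: E)
  case Nil
  have Z: "1 \<le> Z" using bit_length_pos(2)[of N] N(2) by linarith
  have N0: "0 < N" using N(1) by simp
  have k1: "bit_length k \<le> Z" "bit_length (2 * k) \<le> Z"
    using bit_length_mono[of k "4 * k"] bit_length_mono[of "2 * k" "4 * k"] k by auto
  define Y where "Y = Suc k * (Suc L * (Z * 4 ^ (4 * k)))"
  have Y1: "Z * 4 ^ (4 * k) \<le> Y" unfolding Y_def by simp
  have "Suc k * (Suc (length E) * (Z * 4 ^ (4 * k))) \<le> Y"
    unfolding Y_def using Nil.prems(2) by (intro mult_le_mono) simp_all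
  moreover have "fn 8 (Atom N \<bullet> Atom (binop_val Times 2 k) \<bullet> edges_val E \<bullet> Atom k \<bullet> enc N (4 * k) unit_ext)
    (Atom (nat ((edges_step (2 * k) E ^^ k) unit_ext (replicate (4 * k) True) mod int N)))
    (5000 * (Suc k * (Suc (length E) * (Z * 4 ^ (4 * k)))))"
    using iterate_fn[OF N0 N(2) k1(2,1) Nil.prems(1), of unit_ext] by simp
  ultimately have it: "fn 8 (Atom N \<bullet> Atom (binop_val Times 2 k) \<bullet> edges_val E \<bullet> Atom k \<bullet> enc N (4 * k) unit_ext)
    (Atom (nat ((edges_step (2 * k) E ^^ k) unit_ext (replicate (4 * k) True) mod int N)))
    (5000 * Y)"
    using fn_mono mult_le_mono2 by blast
  have un: "fn 3 (Atom N \<bullet> Atom (binop_val Times 4 k)) (enc N (4 * k) unit_ext) (200 * (Z * 4 ^ (4 * k)))"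
    using unit_fn[OF N k] by simp
  have "10000 * Y + 100 * Z \<le> D" using D unfolding Y_def by linarith
  moreover have "Z \<le> Z * 4 ^ (4 * k)" by simp
  ultimately have arith: "60 + 2 * bit_length k + 200 * (Z * 4 ^ (4 * k)) + 5000 * Y \<le> D"
    using Y1 k1 Z by linarith
  show ?case
    unfolding vlist.simps list.map
    by (rule score_fnI, (rule ev_rules ev_If_False it un)+)
      (use arith in \<open>simp_all add: negatives_def\<close>)
next
  case (Cons s S)
  obtain P l where s: "s = (P, l)" by (cases s)
  have Z: "1 \<le> Z" using bit_length_pos(2)[of N] N(2) by linarith
  define T where "T = Suc (length S) * 2 ^ negatives S"
  define Y where "Y = 200 * (Suc L * (Suc Z * Suc Q))"
  have sub: "set (common_edges E P) \<subseteq> set E" "length (common_edges E P) \<le> length E"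
    by (auto simp: common_edges_def)
  have IH: "fn 11 (Atom N \<bullet> Atom k \<bullet> edges_val E \<bullet> samples_val S) (Atom (nat (score k E S mod int N))) (D * T)"
    unfolding T_def by (rule Cons.IH) (use Cons.prems in auto)
  have IH': "fn 11 (Atom N \<bullet> Atom k \<bullet> edges_val (common_edges E P) \<bullet> samples_val S)
      (Atom (nat (score k (common_edges E P) S mod int N))) (D * T)"
    unfolding T_def by (rule Cons.IH) (use Cons.prems sub in auto)
  have "fn 10 (edges_val E \<bullet> edges_val P) (edges_val (common_edges E P))
      (200 * (Suc (length E) * (Suc Z * Suc (length P))))"
    by (rule common_fn) (use Cons.prems in \<open>auto simp: s small_def\<close>)
  moreover have "200 * (Suc (length E) * (Suc Z * Suc (length P))) \<le> Y"
    unfolding Y_def using Cons.prems by (intro mult_le_mono) (auto simp: s)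
  ultimately have co: "fn 10 (edges_val E \<bullet> edges_val P) (edges_val (common_edges E P)) Y"
    by (rule fn_mono)
  have "Suc L \<le> Suc L * (Suc Z * Suc Q)" by simp
  then have Y200: "200 \<le> Y" unfolding Y_def by linarith
  have DY: "Y + 100 * Z \<le> D" using D unfolding Y_def by linarith
  show ?case
  proof (cases l)
    case True
    have T: "Suc (length (s # S)) * 2 ^ negatives (s # S) = T + 2 ^ negatives S"
      using True by (simp add: T_def negatives_def s)
    have "D * 1 \<le> D * 2 ^ negatives S" by (intro mult_le_mono2) simp
    then have arith: "50 + Y + D * T \<le> D * (T + 2 ^ negatives S)"
      unfolding distrib_left using DY Z by linarith
    show ?thesis
      unfolding T unfolding vlist.simps list.map s sample_val_Pair
      by (rule score_fnI, (rule ev_rules ev_If_True IH' co)+)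
        (use arith True in simp_all)
  next
    case False
    have T: "Suc (length (s # S)) * 2 ^ negatives (s # S) = 2 * T + 2 * 2 ^ negatives S"
      using False by (simp add: T_def negatives_def s)
    have D1: "D * 1 \<le> D * 2 ^ negatives S" by (intro mult_le_mono2) simp
    let ?a = "nat (score k E S mod int N)" and ?b = "nat (score k (common_edges E P) S mod int N)"
    have N0: "0 < N" using N(1) by simp
    have bits: "bit_length ?a \<le> Z" "bit_length ?b \<le> Z" "bit_length (N - 1) \<le> Z"
      "bit_length ((N - 1) * ?b) \<le> 2 * Z" "bit_length (?a + (N - 1) * ?b) \<le> 3 * Z"
    proof -
      show a: "bit_length ?a \<le> Z" and b: "bit_length ?b \<le> Z"
        using bit_length_residue[OF N0] N(2) order_trans by blast+
      show c: "bit_length (N - 1) \<le> Z" using bit_length_mono[of "N - 1" N] N(2) by simp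
      show d: "bit_length ((N - 1) * ?b) \<le> 2 * Z" using bit_length_mult[of "N - 1" ?b] b c by linarith
      show "bit_length (?a + (N - 1) * ?b) \<le> 3 * Z" using bit_length_add[of ?a "(N - 1) * ?b"] a d by linarith
    qed
    have "(?a + (N - 1) * ?b) mod N = nat ((score k E S + int (N - 1) * score k (common_edges E P) S) mod int N)"
      using comb_leaf[OF N0, of 1 "score k E S" "N - 1" "score k (common_edges E P) S"] by simp
    then have val: "(?a + (N - Suc 0) * ?b) mod N = nat ((score k E S - score k (common_edges E P) S) mod int N)"
      using minus_one_mod[OF N0] by simp
    have arith: "80 + 15 * Z + Y + D * T + D * T \<le> D * (2 * T + 2 * 2 ^ negatives S)"
      unfolding distrib_left mult.left_commute[of D 2] using DY Z D1 by linarith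
    show ?thesis
      unfolding T unfolding vlist.simps list.map s sample_val_Pair
      by (rule score_fnI, rule ev_If_True, (rule ev_rules)+, rule ev_If_False, (rule ev_rules IH IH' co)+)
        (use arith False bits N(2) Z in \<open>simp_all add: val\<close>)
  qed
qed

section \<open>Cost of the list functions and of the search\<close>

lemma star_fn:
  "fn 12 (Atom v \<bullet> vlist (map Atom V) (Atom 0) \<bullet> z) (vlist (map edge_val (map (Pair v) V)) z)
    (50 * Suc (length V))"
proof (induction V)
  case Nil
  show ?case unfolding vlist.simps list.map
    by (rule star_fnI, (rule ev_rules ev_If_False)+) simp_all
next
  case (Cons w V)
  show ?case unfolding vlist.simps list.map edge_val_Pair
    by (rule star_fnI, (rule ev_rules ev_If_True Cons.IH)+) simp_all
qed

lemma pairs_fn: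
  "fn 13 (vlist (map Atom V) (Atom 0)) (edges_val (pairs V)) (100 * (Suc (length V) * Suc (length V)))"
proof (induction V)
  case Nil
  show ?case unfolding vlist.simps list.map
    by (rule pairs_fnI, (rule ev_rules ev_If_False)+) simp_all
next
  case (Cons v V)
  show ?case unfolding vlist.simps list.map
    by (rule pairs_fnI, (rule ev_rules ev_If_True star_fn Cons.IH)+) (simp_all add: vlist_append)
qed

lemma positive_fn:
  "fn 14 (samples_val S) (Atom (of_bool (\<exists>s\<in>set S. snd s))) (30 * Suc (length S))"
proof (induction S)
  case Nil
  show ?case unfolding vlist.simps list.map
    by (rule positive_fnI, (rule ev_rules ev_If_False)+) simp_all
next
  case (Cons s S)
  obtain P l where s: "s = (P, l)" by (cases s)
  show ?case
  proof (cases l)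
    case True
    show ?thesis unfolding vlist.simps list.map s sample_val_Pair
      by (rule positive_fnI, (rule ev_rules ev_If_True)+) (simp_all add: True)
  next
    case False
    show ?thesis unfolding vlist.simps list.map s sample_val_Pair
      by (rule positive_fnI, rule ev_If_True, (rule ev_rules)+, rule ev_If_False, (rule ev_rules Cons.IH)+)
        (simp_all add: False)
  qed
qed

lemma bit_length_le_Suc: "bit_length n \<le> Suc n"
proof (rule bit_length_le)
  show "n < 2 ^ Suc n" using less_exp[of "Suc n"] by linarith
qed simp

text \<open>Quadratic, since each increment is charged the bit length of the counter, crudely
  bounded by the counter plus 1.\<close>

lemma length_fn: "fn 15 (vlist xs (Atom 0)) (Atom (length xs)) (50 * (Suc (length xs) * Suc (length xs)))"
proof (induction xs)
  case Nil
  show ?case unfolding vlist.simps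
    by (rule length_fnI, (rule ev_rules ev_If_False)+) simp_all
next
  case (Cons x xs)
  show ?case unfolding vlist.simps
    by (rule length_fnI, (rule ev_rules ev_If_True Cons.IH)+)
      (use bit_length_le_Suc[of "length xs"] in simp_all)
qed

lemma take_fn:
  "k \<le> length xs \<Longrightarrow> bit_length k \<le> Z \<Longrightarrow>
    fn 16 (Atom k \<bullet> vlist xs (Atom 0)) (vlist (take k xs) (Atom 0)) (50 * (Z * Suc k))"
proof (induction k arbitrary: xs)
  case 0
  have "1 \<le> Z" using bit_length_pos(2)[of 0] 0(2) by linarith
  then show ?case
    by - (rule take_fnI, (rule ev_rules ev_If_False)+, simp_all)
next
  case (Suc k)
  then obtain x ys where xs: "xs = x # ys" by (cases xs) auto
  have Z: "1 \<le> Z" using bit_length_pos(2)[of "Suc k"] Suc.prems(2) by linarith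
  have "bit_length k \<le> Z" using bit_length_mono[of k "Suc k"] Suc.prems(2) by simp
  then have IH: "fn 16 (Atom (binop_val Minus (Suc k) 1) \<bullet> vlist ys (Atom 0)) (vlist (take k ys) (Atom 0))
      (50 * (Z * Suc k))"
    using Suc.IH[of ys] Suc.prems(1) by (simp add: xs)
  show ?case unfolding xs vlist.simps
    by (rule take_fnI, (rule ev_rules ev_If_True IH)+) (use Z Suc.prems(2) in simp_all)
qed

lemma append_fn: "fn 17 (vlist xs (Atom 0) \<bullet> z) (vlist xs z) (50 * Suc (length xs))"
proof (induction xs)
  case Nil
  show ?case unfolding vlist.simps
    by (rule append_fnI, (rule ev_rules ev_If_False)+) simp_all
next
  case (Cons x xs)
  show ?case unfolding vlist.simps
    by (rule append_fnI, (rule ev_rules ev_If_True Cons.IH)+) simp_all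
qed

text \<open>The only multiple of \<open>N\<close> of absolute value below \<open>N\<close> is 0.
  This makes the test on residues exact.\<close>

lemma nat_mod_nonzero: "\<bar>x\<bar> < int N \<Longrightarrow> nat (x mod int N) = 0 \<longleftrightarrow> x = 0"
proof -
  assume x: "\<bar>x\<bar> < int N"
  then have "0 \<le> x mod int N" by simp
  then have "nat (x mod int N) = 0 \<longleftrightarrow> int N dvd x" by (auto simp: dvd_eq_mod_eq_0)
  also have "\<dots> \<longleftrightarrow> x = 0" using x zdvd_not_zless[of "\<bar>x\<bar>" "int N"] by fastforce
  finally show ?thesis .
qed

lemma prune_fn:
  assumes score: "\<And>E. distinct E \<Longrightarrow> set E \<subseteq> A \<Longrightarrow>
      fn 11 (Atom N \<bullet> Atom k \<bullet> edges_val E \<bullet> samples_val S) (Atom (nat (score k E S mod int N))) D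
      \<and> \<bar>score k E S\<bar> < int N"
    and "distinct (kept @ todo)" "set (kept @ todo) \<subseteq> A" "length (kept @ todo) \<le> L"
  shows "fn 18 (Atom N \<bullet> Atom k \<bullet> samples_val S \<bullet> edges_val kept \<bullet> edges_val todo)
    (edges_val (prune k S kept todo)) (Suc (length todo) * (D + 50 * L + 150))"
  using assms(2-)
proof (induction todo arbitrary: kept)
  case Nil
  show ?case unfolding vlist.simps list.map
    by (rule prune_fnI, (rule ev_rules ev_If_False)+) simp_all
next
  case (Cons e todo)
  let ?E = "kept @ todo"
  have E: "fn 11 (Atom N \<bullet> Atom k \<bullet> edges_val ?E \<bullet> samples_val S) (Atom (nat (score k ?E S mod int N))) D"
    "\<bar>score k ?E S\<bar> < int N"
    using score[of ?E] Cons.prems by auto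
  have "fn 17 (edges_val kept \<bullet> edges_val todo) (edges_val ?E) (50 * Suc (length kept))"
    using append_fn[of "map edge_val kept" "edges_val todo"] by (simp add: vlist_append)
  moreover have "50 * Suc (length kept) \<le> 50 * L" using Cons.prems(3) by simp
  ultimately have ap: "fn 17 (edges_val kept \<bullet> edges_val todo) (edges_val ?E) (50 * L)"
    by (rule fn_mono)
  show ?case
  proof (cases "score k ?E S = 0")
    case False
    have IH: "fn 18 (Atom N \<bullet> Atom k \<bullet> samples_val S \<bullet> edges_val kept \<bullet> edges_val todo)
      (edges_val (prune k S kept todo)) (Suc (length todo) * (D + 50 * L + 150))"
      by (rule Cons.IH) (use Cons.prems in auto)
    show ?thesis unfolding vlist.simps list.map
      by (rule prune_fnI, (rule ev_rules ev_If_True IH E(1) ap)+)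
        (use False nat_mod_nonzero[OF E(2)] in simp_all)
  next
    case True
    have IH: "fn 18 (Atom N \<bullet> Atom k \<bullet> samples_val S \<bullet> (edge_val e \<bullet> edges_val kept) \<bullet> edges_val todo)
      (edges_val (prune k S (e # kept) todo)) (Suc (length todo) * (D + 50 * L + 150))"
      using Cons.IH[of "e # kept"] Cons.prems by auto
    show ?thesis unfolding vlist.simps list.map
      by (rule prune_fnI, rule ev_If_True, (rule ev_rules)+, rule ev_If_False, (rule ev_rules IH E(1) ap)+)
        (use True nat_mod_nonzero[OF E(2)] in simp_all)
  qed
qed

lemma power_fn:
  assumes "\<And>i. i \<le> j \<Longrightarrow> bit_length (B ^ i) \<le> Z" "bit_length j \<le> Z" "bit_length B \<le> Z"
  shows "fn 19 (Atom B \<bullet> Atom j) (Atom (B ^ j)) (100 * (Z * Suc j))"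
  using assms
proof (induction j)
  case 0
  have "1 \<le> Z" using bit_length_pos(2)[of B] 0(3) by linarith
  then show ?case
    by - (rule power_fnI, (rule ev_rules ev_If_False)+, simp_all)
next
  case (Suc j)
  have Z: "1 \<le> Z" using bit_length_pos(2)[of B] Suc.prems(3) by linarith
  have "bit_length j \<le> Z" using bit_length_mono[of j "Suc j"] Suc.prems(2) by simp
  then have IH: "fn 19 (Atom B \<bullet> Atom (binop_val Minus (Suc j) 1)) (Atom (B ^ j)) (100 * (Z * Suc j))"
    using Suc.IH Suc.prems by simp
  show ?case
    by (rule power_fnI, (rule ev_rules ev_If_True IH)+)
      (use Z Suc.prems(2,3) Suc.prems(1)[of j] in simp_all)
qed

text \<open>A base \<open>B\<close> for the modulus: at least 2, above every label, and with
  \<open>B ^ 2\<close> at least the number of pairs. A sum gives all this in one pass, and its bit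
  length is linear in the input size.\<close>

definition label_bound :: "nat list \<Rightarrow> nat" where
  "label_bound V = 2 + (\<Sum>v\<leftarrow>V. v + 1)"

lemma label_fn:
  assumes "bit_length (label_bound V) \<le> Z"
  shows "fn 20 (vlist (map Atom V) (Atom 0)) (Atom (label_bound V)) (100 * (Z * Suc (length V)))"
  using assms
proof (induction V)
  case Nil
  have "1 \<le> Z" using bit_length_pos(2)[of "label_bound []"] Nil by linarith
  then show ?case unfolding vlist.simps list.map
    by - (rule label_fnI, (rule ev_rules ev_If_False)+, simp_all add: label_bound_def)
next
  case (Cons v V)
  have Z: "1 \<le> Z" using bit_length_pos(2)[of "label_bound (v # V)"] Cons.prems by linarith
  have le: "label_bound V \<le> label_bound (v # V)" "v \<le> label_bound (v # V)" "v + 1 \<le> label_bound (v # V)"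
    by (simp_all add: label_bound_def)
  have bits: "bit_length (label_bound V) \<le> Z" "bit_length v \<le> Z" "bit_length (Suc v) \<le> Z"
    using le[THEN bit_length_mono] Cons.prems by simp_all
  have eq: "label_bound (v # V) = Suc v + label_bound V" by (simp add: label_bound_def)
  show ?case unfolding vlist.simps list.map
    by (rule label_fnI, (rule ev_rules ev_If_True Cons.IH[OF bits(1)])+)
      (use bits Z in \<open>simp_all add: eq\<close>)
qed

section \<open>Running time\<close>

definition modulus_exponent :: "nat \<Rightarrow> nat" where
  "modulus_exponent k = 8 * k * k + 2 * k + 1"

text \<open>For \<open>B < 2 ^ n\<close> the modulus needs about
  \<open>n * modulus_exponent k\<close> bits. The further summands make room for \<open>k\<close>,
  for the exponent itself, and for small constants such as the factor in
  \<open>4 * k\<close>.\<close>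

definition word_bits :: "nat \<Rightarrow> nat \<Rightarrow> nat" where
  "word_bits n k = n * modulus_exponent k + n + modulus_exponent k + 4"

definition score_cost :: "nat \<Rightarrow> nat \<Rightarrow> nat \<Rightarrow> nat" where
  "score_cost n k t =
    (10000 * (Suc k * (Suc (n * n) * (word_bits n k * 4 ^ (4 * k))))
      + 200 * (Suc (n * n) * (Suc (word_bits n k) * Suc n)) + 100 * word_bits n k) * (Suc n * 2 ^ t)"

text \<open>Adds up both branches of the main function. The quadratic term for the length occurs
  twice: once for the call and once for the bit lengths charged when its result is incremented and
  compared.\<close>

definition total_cost :: "nat \<Rightarrow> nat \<Rightarrow> nat \<Rightarrow> nat" where
  "total_cost n k t =
    100 * (Suc n * Suc n) + 30 * Suc n + 2 * (50 * (Suc (n * n) * Suc (n * n)))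
      + 50 * (word_bits n k * Suc k) + 100 * (word_bits n k * Suc n)
      + 100 * (word_bits n k * Suc (modulus_exponent k))
      + score_cost n k t + Suc (n * n) * (score_cost n k t + 50 * (n * n) + 150)
      + 500 + 50 * word_bits n k"

lemma power_bound_mult: "a \<le> W ^ p \<Longrightarrow> b \<le> W ^ q \<Longrightarrow> a * b \<le> (W :: nat) ^ (p + q)"
  unfolding power_add by (rule mult_le_mono)

lemma power_bound_add:
  assumes "2 \<le> W" "a \<le> W ^ p" "b \<le> W ^ q"
  shows "a + b \<le> (W :: nat) ^ Suc (max p q)"
proof -
  have "W ^ p \<le> W ^ max p q" "W ^ q \<le> W ^ max p q"
    using assms(1) by (simp_all add: power_increasing)
  then have "a + b \<le> 2 * W ^ max p q" using assms by linarith
  also have "\<dots> \<le> W * W ^ max p q" using assms(1) by (rule mult_le_mono1)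
  finally show ?thesis by simp
qed

lemma power_bound_weaken: "a \<le> W ^ p \<Longrightarrow> p \<le> q \<Longrightarrow> 2 \<le> W \<Longrightarrow> a \<le> (W :: nat) ^ q"
  using power_increasing[of p q W] by linarith

text \<open>Every ingredient is at most a power of \<open>W = 2 ^ (k + t) * n\<close>; in particular
  \<open>4 ^ (4 * k) = (2 ^ k) ^ 8\<close> is at most \<open>W ^ 8\<close>. The two extra units pay
  for the initial call and its argument.\<close>

lemma total_cost_le:
  assumes "2 \<le> n"
  shows "Suc (Suc (total_cost n k t)) \<le> (2 ^ (k + t) * n) ^ 200"
proof -
  define W where "W = 2 ^ (k + t) * n"
  have pos: "1 \<le> (2 :: nat) ^ (k + t)" by simp
  have nW: "n \<le> W ^ 1" using mult_le_mono1[OF pos, of n] by (simp add: W_def)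
  then have W: "2 \<le> W" using assms by simp
  have pW: "2 ^ (k + t) \<le> W ^ 1" using assms by (simp add: W_def)
  have "2 ^ k \<le> (2 :: nat) ^ (k + t)" "2 ^ t \<le> (2 :: nat) ^ (k + t)"
    by (simp_all add: power_increasing)
  then have kW': "2 ^ k \<le> W ^ 1" and tW: "2 ^ t \<le> W ^ 1" using pW by linarith+
  have kW: "k \<le> W ^ 1" using kW' less_exp[of k] by linarith
  have "(4 :: nat) ^ (4 * k) = (2 ^ 2) ^ (4 * k)" by simp
  also have "\<dots> = (2 ^ k) ^ 8" by (simp only: power_mult[symmetric]) (simp add: mult.commute)
  also have "\<dots> \<le> W ^ 8" using power_mono[OF kW', of 8] by simp
  finally have eW: "4 ^ (4 * k) \<le> W ^ 8" .
  \<comment> \<open>\<open>2 ^ 14\<close> exceeds 10000, the largest constant in the cost.\<close>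
  have c: "c \<le> W ^ 14" if "c \<le> 2 ^ 14" for c
    using that power_mono[OF W, of 14] by simp
  have small_numerals: "10000 \<le> W ^ 14" "500 \<le> W ^ 14" "200 \<le> W ^ 14" "150 \<le> W ^ 14" "100 \<le> W ^ 14"
    "50 \<le> W ^ 14" "30 \<le> W ^ 14" "8 \<le> W ^ 14" "4 \<le> W ^ 14" "2 \<le> W ^ 14" "1 \<le> W ^ 14"
    by (rule c, simp)+
  note rules = small_numerals nW kW tW eW power_bound_add[OF W] power_bound_mult
  have "total_cost n k t + 2 \<le> W ^ 200"
    unfolding total_cost_def score_cost_def word_bits_def modulus_exponent_def Suc_eq_plus1
    \<comment> \<open>The rules follow the cost expression and build the exponent on the way:
      products add exponents, sums raise the maximum by one. Only the final exponent is compared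
      with 200.\<close>
    by (rule power_bound_weaken, (rule rules)+) (use W in simp_all)
  then show ?thesis unfolding W_def by simp
qed

lemma search_fn:
  assumes score: "\<And>E. distinct E \<Longrightarrow> set E \<subseteq> set L \<Longrightarrow>
      fn 11 (Atom N \<bullet> Atom k \<bullet> edges_val E \<bullet> samples_val S) (Atom (nat (score k E S mod int N))) D
      \<and> \<bar>score k E S\<bar> < int N"
    and L: "distinct L" "length L \<le> m"
  shows "fn 21 (Atom N \<bullet> Atom k \<bullet> samples_val S \<bullet> edges_val L)
    (if score k L S \<noteq> 0 then edges_val (prune k S [] L) \<bullet> Atom 0 else Atom 0)
    (D + Suc m * (D + 50 * m + 150) + 100)"
proof -
  have sc: "fn 11 (Atom N \<bullet> Atom k \<bullet> edges_val L \<bullet> samples_val S) (Atom (nat (score k L S mod int N))) D"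
    and nz: "\<bar>score k L S\<bar> < int N"
    using score[of L] L by auto
  have "fn 18 (Atom N \<bullet> Atom k \<bullet> samples_val S \<bullet> Atom 0 \<bullet> edges_val L)
    (edges_val (prune k S [] L)) (Suc (length L) * (D + 50 * m + 150))"
    using prune_fn[of "set L" N k S D "[]" L m] score L by simp
  then have pr: "fn 18 (Atom N \<bullet> Atom k \<bullet> samples_val S \<bullet> Atom 0 \<bullet> edges_val L)
    (edges_val (prune k S [] L)) (Suc m * (D + 50 * m + 150))"
    by (rule fn_mono) (use L(2) in \<open>intro mult_le_mono1, simp\<close>)
  show ?thesis
  proof (cases "score k L S = 0")
    case True
    show ?thesis
      by (rule search_fnI, (rule ev_rules ev_If_False sc)+) (use True in simp_all)
  next
    case False
    show ?thesis
      by (rule search_fnI, (rule ev_rules ev_If_True sc pr)+)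
        (use False nat_mod_nonzero[OF nz] in simp_all)
  qed
qed

definition answer_val :: "edge list option \<Rightarrow> val" where
  "answer_val a = (case a of None \<Rightarrow> Atom 0 | Some R \<Rightarrow> edges_val R \<bullet> Atom 0)"

lemma main_fn:
  assumes V: "distinct V" "length V \<le> n" "label_bound V < 2 ^ n"
    and S: "length S \<le> n" "\<forall>s\<in>set S. length (fst s) \<le> n \<and>
      (\<forall>f\<in>set (fst s). fst f \<in> set V \<and> snd f \<in> set V)"
    and k: "bit_length k \<le> n"
  shows "fn 0 (vlist (map Atom V) (Atom 0) \<bullet> samples_val S \<bullet> Atom k) (answer_val (solve V S k))
    (total_cost n k (negatives S))"
proof -
  define e where "e = modulus_exponent k"
  define B where "B = label_bound V"
  define N where "N = B ^ e"
  define Z where "Z = word_bits n k"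
  define D where "D = score_cost n k (negatives S)"
  let ?L = "pairs V"
  have Z_eq: "Z = n * e + n + e + 4" by (simp add: Z_def word_bits_def e_def)
  have e1: "1 \<le> e" "2 * k \<le> e" "8 * k * k \<le> e" "8 * k * k + 2 * k \<le> e"
    by (simp_all add: e_def modulus_exponent_def)
  have "8 * k \<le> 8 * k * k" by (cases k) simp_all
  then have e8: "8 * k \<le> e" using e1 by linarith
  have B2: "2 \<le> B" by (simp add: B_def label_bound_def)
  have powB: "bit_length (B ^ i) \<le> Z" if "i \<le> e" for i
  proof (rule bit_length_le)
    have "B ^ i \<le> (2 ^ n) ^ i" using V(3) by (intro power_mono) (simp_all add: B_def)
    also have "\<dots> = 2 ^ (n * i)" by (simp add: power_mult)
    also have "\<dots> \<le> 2 ^ (n * e)" using that by (intro power_increasing) simp_all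
    also have "\<dots> < 2 ^ Z" unfolding Z_eq by (intro power_strict_increasing) simp_all
    finally show "B ^ i < 2 ^ Z" .
  qed (simp add: Z_eq)
  have BZ: "bit_length B \<le> Z" using powB[of 1] e1 by simp
  have NZ: "bit_length N \<le> Z" using powB[of e] by (simp add: N_def)
  have "B ^ 1 \<le> B ^ e" using e1 B2 by (intro power_increasing) simp_all
  then have N2: "2 \<le> N" using B2 by (simp add: N_def)
  have vB: "v < B" if "v \<in> set V" for v
    using member_le_sum_list[of "v + 1" "map (\<lambda>v. v + 1) V"] that
    by (force simp: B_def label_bound_def)
  have vZ: "small Z (2 * k) v" if "v \<in> set V" for v
  proof -
    have "bit_length v \<le> Z" using bit_length_mono[of v B] vB[OF that] BZ by simp
    moreover have "bit_length (v ^ i) \<le> Z" if "i \<le> 2 * k" for i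
    proof -
      have "v ^ i \<le> B ^ i" using vB[OF \<open>v \<in> set V\<close>] by (intro power_mono) simp_all
      from bit_length_mono[OF this] show ?thesis using powB[of i] that e1 by simp
    qed
    ultimately show ?thesis by (simp add: small_def)
  qed
  have k4: "bit_length (4 * k) \<le> Z" using bit_length_mult[of 4 k] k by (simp add: Z_eq)
  have "length V \<le> (\<Sum>v\<leftarrow>V. v + 1)" by (induction V) simp_all
  then have VB: "length V \<le> B" by (simp add: B_def label_bound_def)
  have LB: "length ?L \<le> B ^ 2"
    using length_pairs_le[of V] power_mono[OF VB, of 2] by linarith
  have Ln: "length ?L \<le> n * n"
    using length_pairs_le[of V] power_mono[OF V(2), of 2] by (simp add: power2_eq_square)
  have Ld: "distinct ?L" using distinct_pairs[OF V(1)] by (simp add: distinct_map)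
  have score: "fn 11 (Atom N \<bullet> Atom k \<bullet> edges_val E \<bullet> samples_val S) (Atom (nat (score k E S mod int N))) D
      \<and> \<bar>score k E S\<bar> < int N" if E: "distinct E" "set E \<subseteq> set ?L" for E
  proof
    have lab: "fst f \<in> set V \<and> snd f \<in> set V" if "f \<in> set E" for f
      using set_pairs_subset E(2) that by blast
    have len: "length E \<le> length ?L"
      using E Ld by (metis List.finite_set card_mono distinct_card)
    have "fn 11 (Atom N \<bullet> Atom k \<bullet> edges_val E \<bullet> samples_val S) (Atom (nat (score k E S mod int N)))
      ((10000 * (Suc k * (Suc (n * n) * (Z * 4 ^ (4 * k))))
        + 200 * (Suc (n * n) * (Suc Z * Suc n)) + 100 * Z) * (Suc (length S) * 2 ^ negatives S))"
    proof (rule score_fn[OF N2 NZ k4])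
      show "\<forall>e\<in>set E. small Z (2 * k) (fst e) \<and> small Z (2 * k) (snd e)"
        using lab vZ by blast
      show "length E \<le> n * n" using len Ln by simp
      show "\<forall>s\<in>set S. length (fst s) \<le> n \<and>
        (\<forall>f\<in>set (fst s). bit_length (fst f) \<le> Z \<and> bit_length (snd f) \<le> Z)"
        using S(2) vZ unfolding small_def by blast
    qed simp
    then show "fn 11 (Atom N \<bullet> Atom k \<bullet> edges_val E \<bullet> samples_val S) (Atom (nat (score k E S mod int N))) D"
      by (rule fn_mono) (use S(1) in \<open>auto simp: D_def score_cost_def Z_def intro!: mult_le_mono\<close>)
    show "\<bar>score k E S\<bar> < int N"
      unfolding N_def e_def modulus_exponent_def
      by (rule score_bound) (use E B2 len LB lab vB in auto)
  qed
  have pa: "fn 13 (vlist (map Atom V) (Atom 0)) (edges_val ?L) (100 * (Suc n * Suc n))"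
    by (rule fn_mono[OF pairs_fn]) (use V(2) in \<open>intro mult_le_mono2 mult_le_mono; simp\<close>)
  have po: "fn 14 (samples_val S) (Atom (of_bool (\<exists>s\<in>set S. snd s))) (30 * Suc n)"
    by (rule fn_mono[OF positive_fn]) (use S(1) in simp)
  have le: "fn 15 (edges_val ?L) (Atom (length ?L)) (50 * (Suc (n * n) * Suc (n * n)))"
  proof (rule fn_mono)
    show "fn 15 (edges_val ?L) (Atom (length ?L)) (50 * (Suc (length ?L) * Suc (length ?L)))"
      using length_fn[of "map edge_val ?L"] by (simp only: length_map)
  qed (use Ln in \<open>intro mult_le_mono2 mult_le_mono; simp\<close>)
  have kZ: "bit_length k \<le> Z" using k by (simp add: Z_eq)
  have lenZ: "bit_length (length ?L) \<le> Suc (n * n)" "bit_length (length ?L + 1) \<le> Suc (Suc (n * n))"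
    using bit_length_mono[OF Ln] bit_length_le_Suc[of "n * n"]
      bit_length_le_Suc[of "length ?L + 1"] Ln by simp_all
  define X where "X = 50 * (Suc (n * n) * Suc (n * n))"
  have bool1: "bit_length (of_bool p * of_bool q) = 1" for p q by (cases p; cases q) simp_all
  let ?c = "Atom (binop_val Times (binop_val Equal (of_bool (\<exists>s\<in>set S. snd s)) 0)
      (binop_val Times (binop_val Less 1 k) (binop_val Less k (binop_val Plus (length ?L) 1))))"
  have Z4: "4 \<le> Z" by (simp add: Z_eq)
  have tot: "total_cost n k (negatives S) = 100 * (Suc n * Suc n) + 30 * Suc n + 2 * X
      + 50 * (Z * Suc k) + 100 * (Z * Suc n) + 100 * (Z * Suc e) + D
      + Suc (n * n) * (D + 50 * (n * n) + 150) + 500 + 50 * Z"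
    by (simp only: total_cost_def X_def Z_def e_def D_def)
  have lenX: "bit_length (length ?L) + bit_length (Suc (length ?L)) \<le> X + 10"
    using lenZ unfolding X_def by simp
  have le2: "fn 15 (edges_val ?L) (Atom (length ?L)) X" using le by (simp only: X_def)
  show ?thesis
  proof (cases "\<not> (\<exists>s\<in>set S. snd s) \<and> 1 < k \<and> k \<le> length ?L")
    case True
    then have nz: "?c \<noteq> Atom 0" by auto
    have ta: "fn 16 (Atom k \<bullet> edges_val ?L) (edges_val (take k ?L)) (50 * (Z * Suc k))"
      using take_fn[of k "map edge_val ?L" Z] True kZ by (simp add: take_map)
    have "solve V S k = Some (take k ?L)" using True by (simp add: solve_def)
    then have ans: "answer_val (solve V S k) = edges_val (take k ?L) \<bullet> Atom 0"
      by (simp add: answer_val_def)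
    show ?thesis
      unfolding tot ans
      by (rule main_fnI, (rule ev_rules ev_If_True pa po le2 ta)+)
        (use nz lenX kZ bool1 Z4 in \<open>simp_all add: take_map\<close>)
  next
    case False
    then have z: "?c = Atom 0" by auto
    have ans: "answer_val (solve V S k)
        = (if score k ?L S \<noteq> 0 then edges_val (prune k S [] ?L) \<bullet> Atom 0 else Atom 0)"
      unfolding solve_def if_not_P[OF False] by (simp add: answer_val_def)
    have la: "fn 20 (vlist (map Atom V) (Atom 0)) (Atom B) (100 * (Z * Suc n))"
      unfolding B_def
    proof (rule fn_mono[OF label_fn])
      show "bit_length (label_bound V) \<le> Z" using BZ by (simp add: B_def)
    qed (use V(2) in \<open>intro mult_le_mono2, simp\<close>)
    have eZ: "bit_length e \<le> Z" using bit_length_le_Suc[of e] by (simp add: Z_eq)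
    have "fn 19 (Atom B \<bullet> Atom e) (Atom N) (100 * (Z * Suc e))"
      unfolding N_def by (rule power_fn) (use powB eZ BZ in auto)
    then have pw: "fn 19 (Atom B \<bullet> Atom (binop_val Plus (binop_val Plus
        (binop_val Times (binop_val Times 8 k) k) (binop_val Times 2 k)) 1)) (Atom N) (100 * (Z * Suc e))"
      by (simp add: e_def modulus_exponent_def)
    have bits: "bit_length (8 * k) \<le> Z" "bit_length (8 * k * k) \<le> Z" "bit_length (2 * k) \<le> Z"
      "bit_length (8 * k * k + 2 * k) \<le> Z"
      using bit_length_mono[OF e8] e1(2-4)[THEN bit_length_mono] eZ by simp_all
    note se = search_fn[OF score Ld Ln]
    show ?thesis
      unfolding tot ans
      by (rule main_fnI, (rule ev_rules ev_If_False pa po le2 la pw se)+)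
        (use z lenX kZ bool1 Z4 bits in \<open>simp_all\<close>)
  qed
qed

section \<open>Decoding the input and correctness of the program\<close>

lemma length_le_val_size: "length xs \<le> val_size (vlist xs z)"
  by (induction xs) simp_all

lemma val_size_mem: "x \<in> set xs \<Longrightarrow> val_size x \<le> val_size (vlist xs z)"
  by (induction xs) auto

text \<open>Use \<open>Suc v \<le> 2 ^ bit_length v\<close> and bound a sum of two powers of 2 by
  twice their product; the factor 2 is paid for by the additional cell.\<close>

lemma label_bound_le: "label_bound V \<le> 2 ^ Suc (val_size (vlist (map Atom V) (Atom 0)))"
proof (induction V)
  case (Cons v V)
  let ?m = "Suc (val_size (vlist (map Atom V) (Atom 0)))"
  have "label_bound (v # V) = Suc v + label_bound V" by (simp add: label_bound_def)
  also have "\<dots> \<le> 2 ^ bit_length v + 2 ^ ?m"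
    using Cons less_bit_length[of v] by (intro add_mono) simp_all
  also have "\<dots> \<le> 2 ^ (bit_length v + ?m) + 2 ^ (bit_length v + ?m)"
    by (intro add_mono power_increasing) simp_all
  also have "\<dots> = 2 ^ Suc (val_size (vlist (map Atom (v # V)) (Atom 0)))" by simp
  finally show ?case .
qed (simp add: label_bound_def)

lemma list_code_nat: "list_code nat_code xs v \<Longrightarrow> v = vlist (map Atom xs) (Atom 0)"
  by (induction xs arbitrary: v) (auto simp: nat_code_def)

text \<open>Read from left to right it decodes the samples, fixing the orientations as listed; from
  right to left it shows that the output encodes a set of edges.\<close>

lemma list_code_edges:
  "list_code edge_code es v \<longleftrightarrow> (\<exists>P. v = edges_val P \<and> map ends P = es)"
proof (induction es arbitrary: v)
  case (Cons e es)
  have e: "edge_code e a \<longleftrightarrow> (\<exists>p. a = edge_val p \<and> ends p = e)" for a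
    by (auto simp: edge_code_def edge_val_def ends_def)
  show ?case
  proof
    assume "list_code edge_code (e # es) v"
    then obtain a b where v: "v = a \<bullet> b" "edge_code e a" "list_code edge_code es b" by auto
    from v(2) e obtain p where p: "a = edge_val p" "ends p = e" by blast
    from v(3) Cons.IH obtain P where P: "b = edges_val P" "map ends P = es" by blast
    have "v = edges_val (p # P) \<and> map ends (p # P) = e # es" by (simp add: v p P)
    then show "\<exists>P. v = edges_val P \<and> map ends P = e # es" ..
  next
    assume "\<exists>P. v = edges_val P \<and> map ends P = e # es"
    then obtain p P where P: "v = edges_val (p # P)" "ends p = e" "map ends P = es"
      by (metis list.map_disc_iff list.simps(9) neq_Nil_conv list.inject list.distinct(1))
    have "list_code edge_code es (edges_val P)" unfolding Cons.IH using P(3) by blast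
    moreover have "edge_code e (edge_val p)" using e P(2) by blast
    ultimately show "list_code edge_code (e # es) v" by (simp add: P(1))
  qed
qed simp

lemma list_code_samples:
  "list_code (prod_code (set_code edge_code) bool_code) ss v \<Longrightarrow>
    \<exists>S. v = samples_val S \<and> map (\<lambda>s. (ends ` set (fst s), snd s)) S = ss"
proof (induction ss arbitrary: v)
  case (Cons s ss)
  from Cons.prems obtain a b where v: "v = a \<bullet> b" and a: "prod_code (set_code edge_code) bool_code s a"
    and b: "list_code (prod_code (set_code edge_code) bool_code) ss b"
    unfolding list_code.simps by blast
  from Cons.IH[OF b] obtain S where S: "b = samples_val S"
    "map (\<lambda>s. (ends ` set (fst s), snd s)) S = ss" by blast
  from a obtain p where p: "a = p \<bullet> Atom (of_bool (snd s))" "set_code edge_code (fst s) p"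
    unfolding prod_code_def bool_code_def by blast
  from p(2) obtain es where es: "set es = fst s" "list_code edge_code es p"
    unfolding set_code_def by blast
  from es(2) obtain P where "p = edges_val P" "map ends P = es"
    unfolding list_code_edges by blast
  then have P: "p = edges_val P" "ends ` set P = fst s" using es(1) by (simp_all flip: set_map)
  have "v = samples_val ((P, snd s) # S)"
    by (simp only: v S(1) p(1) P(1) list.map vlist.simps sample_val_Pair)
  moreover have "map (\<lambda>s. (ends ` set (fst s), snd s)) ((P, snd s) # S) = s # ss"
    by (simp add: S(2) P(2))
  ultimately show ?case by (intro exI[of _ "(P, snd s) # S"] conjI)
next
  case Nil
  then show ?case by (intro exI[of _ "[]"]) simp
qed

lemma matching_prog_solves:
  "solves_within matching_prog ConsCheck_Matching
    (\<lambda>I n. 2 ^ (200 * (solution_size I + num_negative I)) * n ^ 200)"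
  unfolding solves_within_def
proof (intro ballI allI impI)
  fix I x
  assume "I \<in> instances ConsCheck_Matching" and "instance_code ConsCheck_Matching I x"
  then have valid: "valid_instance I" and code: "matching_instance_code I x"
    by (simp_all add: ConsCheck_Matching_def)
  let ?k = "solution_size I" and ?n = "val_size x"
  from code obtain v s where x: "x = v \<bullet> s \<bullet> Atom ?k" and v: "set_code nat_code (vertices I) v"
    and s: "list_code (prod_code (set_code edge_code) bool_code) (samples I) s"
    unfolding matching_instance_code_def prod_code_def nat_code_def fst_conv snd_conv by blast
  from v obtain V where V: "distinct V" "set V = vertices I" "list_code nat_code V v"
    unfolding set_code_def by blast
  note v_eq = list_code_nat[OF V(3)]
  from list_code_samples[OF s] obtain S where S: "s = samples_val S"
    "map (\<lambda>s. (ends ` set (fst s), snd s)) S = samples I" by blast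
  have samples: "set (samples I) = (\<lambda>s. (ends ` set (fst s), snd s)) ` set S"
    unfolding S(2)[symmetric] by simp
  have consistent: "consistent_matching I F \<longleftrightarrow> consistent V S ?k F" for F
    unfolding consistent_matching_def consistent_def matching_in_def samples V(2)
    by (simp add: split_beta)
  have neg: "negatives S = num_negative I"
  proof -
    have "num_negative I = length (filter (\<lambda>s. \<not> snd s) (samples I))"
      by (simp add: num_negative_def length_filter_conv_card)
    then show ?thesis unfolding S(2)[symmetric] by (simp add: negatives_def filter_map comp_def)
  qed
  have "fn 0 x (answer_val (solve V S ?k)) (total_cost ?n ?k (negatives S))"
    unfolding x v_eq S(1)
  proof (rule main_fn)
    let ?n = "val_size (vlist (map Atom V) (Atom 0) \<bullet> samples_val S \<bullet> Atom ?k)"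
    show "distinct V" by (rule V)
    show "length V \<le> ?n" using length_le_val_size[of "map Atom V" "Atom 0"] by simp
    \<comment> \<open>Strict because the samples, \<open>k\<close> and two cells also contribute to
      the size of the input.\<close>
    have "(2 :: nat) ^ Suc (val_size (vlist (map Atom V) (Atom 0))) < 2 ^ ?n"
      by (rule power_strict_increasing) simp_all
    then show "label_bound V < 2 ^ ?n" using label_bound_le[of V] by linarith
    show "length S \<le> ?n" using length_le_val_size[of "map sample_val S" "Atom 0"] by simp
    show "bit_length ?k \<le> ?n" by simp
    show "\<forall>s\<in>set S. length (fst s) \<le> ?n \<and> (\<forall>f\<in>set (fst s). fst f \<in> set V \<and> snd f \<in> set V)"
    proof (intro ballI conjI)
      fix s assume s: "s \<in> set S"
      have "length (fst s) \<le> val_size (sample_val s)"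
        using length_le_val_size[of "map edge_val (fst s)" "Atom 0"] by (simp add: sample_val_def)
      also have "\<dots> \<le> val_size (samples_val S)" using s by (intro val_size_mem) simp
      finally show "length (fst s) \<le> ?n" by simp
      fix f assume f: "f \<in> set (fst s)"
      have mem: "(ends ` set (fst s), snd s) \<in> set (samples I)"
        unfolding samples using s by (rule imageI)
      have "\<forall>(E, l)\<in>set (samples I). E \<subseteq> [vertices I]\<^bsup>2\<^esup>"
        using valid by (simp add: valid_instance_def)
      from bspec[OF this mem] have "ends ` set (fst s) \<subseteq> [vertices I]\<^bsup>2\<^esup>" by simp
      from this imageI[OF f] have "ends f \<in> [set V]\<^bsup>2\<^esup>" unfolding V(2) by (rule subsetD)
      then show "fst f \<in> set V" "snd f \<in> set V" by (auto simp: nsets_def ends_def)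
    qed
  qed
  then have "ev [x] (Call 0 (Var 0)) (answer_val (solve V S ?k)) (1 + 1 + total_cost ?n ?k (negatives S))"
    by (rule ev_Call[OF ev_Var(1)])
  then obtain c where c: "c \<le> Suc (Suc (total_cost ?n ?k (num_negative I)))"
    "eval matching_prog [x] (Call 0 (Var 0)) (answer_val (solve V S ?k)) c"
    unfolding ev_def neg by auto
  have "2 \<le> ?n" by (simp add: x)
  from total_cost_le[OF this] c(1)
  have "c \<le> (2 ^ (?k + num_negative I) * ?n) ^ 200" by (rule order_trans[rotated])
  also have "\<dots> = 2 ^ (200 * (?k + num_negative I)) * ?n ^ 200"
    by (simp only: power_mult_distrib power_mult[symmetric] mult.commute)
  finally have time: "c \<le> 2 ^ (200 * (?k + num_negative I)) * ?n ^ 200" .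
  let ?ans = "map_option (\<lambda>R. ends ` set R) (solve V S ?k)"
  have "option_code (set_code edge_code) ?ans (answer_val (solve V S ?k)) \<and>
    correct_answer ConsCheck_Matching I ?ans"
  proof (cases "solve V S ?k")
    case None
    with solve_correct[OF V(1), of S ?k] show ?thesis
      by (simp add: answer_val_def ConsCheck_Matching_def consistent)
  next
    case (Some R)
    with solve_correct[OF V(1), of S ?k]
    have R: "consistent V S ?k (ends ` set R)" "distinct (map ends R)" by simp_all
    then have "set_code edge_code (ends ` set R) (edges_val R)"
      unfolding set_code_def list_code_edges by (intro exI[of _ "map ends R"]) auto
    with Some R(1) show ?thesis
      by (simp add: answer_val_def ConsCheck_Matching_def consistent)
  qed
  with c(2) time show "\<exists>y c ans. runs matching_prog x y c \<and>
      c \<le> 2 ^ (200 * (?k + num_negative I)) * ?n ^ 200 \<and>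
      option_code (solution_code ConsCheck_Matching) ans y \<and> correct_answer ConsCheck_Matching I ans"
    by (intro exI[of _ "answer_val (solve V S ?k)"] exI[of _ c] exI[of _ ?ans])
      (simp add: runs_def ConsCheck_Matching_def)
qed

text \<open>Fixed-parameter tractability asks for a computable parameter dependence. Plain recursion
  on \<open>m\<close> suffices, as only termination matters here and not the time.\<close>

lemma computable_exp: "computable (\<lambda>m. K ^ m)"
proof -
  let ?p = "[If_Nonzero (Var 0) (Op Times (Lit K) (Call 0 (Op Minus (Var 0) (Lit 1)))) (Lit 1)]"
  have "\<exists>c. eval ?p [Atom m] (?p ! 0) (Atom (K ^ m)) c" for m
  proof (induction m)
    case 0
    have "eval ?p [Atom 0] (Var 0) (Atom 0) 1" using eval_Var[of 0 "[Atom 0]"] by simp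
    from eval_If_False[OF this eval_Lit[of _ _ 1]] show ?case by auto
  next
    case (Suc m)
    then obtain c where c: "eval ?p [Atom m] (?p ! 0) (Atom (K ^ m)) c" by blast
    have v: "eval ?p [Atom (Suc m)] (Var 0) (Atom (Suc m)) 1"
      using eval_Var[of 0 "[Atom (Suc m)]"] by simp
    have "eval ?p [Atom (Suc m)] (Op Minus (Var 0) (Lit 1)) (Atom (binop_val Minus (Suc m) 1))
        (1 + 1 + 1 + bit_length (Suc m) + bit_length 1)"
      by (rule eval_Op[OF v eval_Lit])
    then have "eval ?p [Atom (Suc m)] (Op Minus (Var 0) (Lit 1)) (Atom m)
        (1 + 1 + 1 + bit_length (Suc m) + bit_length 1)" by simp
    from eval_Call[OF this _ c] have "\<exists>c. eval ?p [Atom (Suc m)] (Call 0 (Op Minus (Var 0) (Lit 1))) (Atom (K ^ m)) c"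
      by auto
    then obtain c' where "eval ?p [Atom (Suc m)] (Call 0 (Op Minus (Var 0) (Lit 1))) (Atom (K ^ m)) c'" ..
    from eval_If_True[OF v _ eval_Op[OF eval_Lit[of _ _ K] this, of Times]] show ?case by auto
  qed
  then have "\<exists>c. runs ?p (Atom m) (Atom (K ^ m)) c" for m
    unfolding runs_def using eval_Call[of ?p "[Atom m]" "Var 0" "Atom m" 1 0] eval_Var[of 0 "[Atom m]" ?p]
    by fastforce
  then show ?thesis unfolding computable_def by blast
qed

theorem theorem9:
  shows "(\<exists>p c d. solves_within p ConsCheck_Matching
            (\<lambda>I n. 2 ^ (c * (solution_size I + num_negative I)) * n ^ d))
       \<and> fixed_parameter_tractable ConsCheck_Matching (\<lambda>I. solution_size I + num_negative I)"
proof
  show "\<exists>p c d. solves_within p ConsCheck_Matching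
      (\<lambda>I n. 2 ^ (c * (solution_size I + num_negative I)) * n ^ d)"
    using matching_prog_solves by blast
  \<comment> \<open>Regrouping the exponent exhibits the parameter dependence as a power with the
    fixed base \<open>2 ^ 200\<close>.\<close>
  have "solves_within matching_prog ConsCheck_Matching
      (\<lambda>I n. (2 ^ 200) ^ (solution_size I + num_negative I) * n ^ 200)"
    using matching_prog_solves by (simp only: power_mult)
  then show "fixed_parameter_tractable ConsCheck_Matching (\<lambda>I. solution_size I + num_negative I)"
    unfolding fixed_parameter_tractable_def using computable_exp[of "2 ^ 200"] by blast
qed

end
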